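(* There exists a computationally efficient mechanism for answering $k$ adaptively chosen queries with the following property. When given $$n\ \ge\ m=\tilde O\left(\frac{\sqrt k}{\alpha^2}\log\frac1\beta\right)$$ samples (an $n$-tuple) from an (unknown) undirected Markov chain $\mu$, the mechanism guarantees $\left(\alpha+2\bar R(\mu),\beta\right)$-statistical-accuracy (with respect to the underlying distribution $\mu$).
   Context: A measure $\mu$ over $\Omega^n$ is an undirected Markov chain if there are positive functions $\{g_i\}_{i\in[n-1]}$ on $\Omega\times\Omega$, called potential functions, such that for any $x\in\Omega^n$ $$\mu(x)=\frac{\prod_{i=1}^{n-1}g_i(x_i,x_{i+1})}{\sum_{x'\in\Omega^n}\prod_{i=1}^{n-1}g_i(x'_i,x'_{i+1})}.$$ With $R(\mu)=\max_{i}\max_{a,b\in\Omega}g_i(a,b)$ and $r(\mu)=\min_{i}\min_{a,b\in\Omega}g_i(a,b)$, set $$\bar R(\mu)=\frac{R(\mu)^2-r(\mu)^2}{R(\mu)^2+r(\mu)^2}.$$ Game: a mechanism receives a dataset $S\in\Omega^n$. For $i=1,\dots,k$, the adversary picks a statistical query $q_i:\Omega\to[0,1]$, possibly depending on all previous answers, and the mechanism responds with an answer $a_i$, which is given to the adversary. For an $n$-tuple $T$ write $q(T)=\frac1n\sum_{x\in T}q(x)$, and write $q(\mu)=\mathbb{E}_{T\sim\mu}[q(T)]$. The mechanism guarantees $(\alpha',\beta)$-statistical-accuracy with respect to $\mu$ if for every adversary, when $S\sim\mu$ and the game is played with dataset $S$, $\Pr\left[\max_{i\in[k]}|q_i(\mu)-a_i|>\alpha'\right]\le\beta$.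 *)

theory Defs
  imports "HOL-Probability.Probability"
begin

section \<open>Undirected Markov chains\<close>

definition tuples :: "'a set \<Rightarrow> nat \<Rightarrow> 'a list set" where
  "tuples \<Omega> n = {x. set x \<subseteq> \<Omega> \<and> length x = n}"

text \<open>Positions are numbered from 0, so the potential \<open>g i\<close> couples the coordinates \<open>i\<close> and
  \<open>i + 1\<close> for \<open>i < n - 1\<close>.\<close>

definition chain_weight :: "nat \<Rightarrow> (nat \<Rightarrow> 'a \<Rightarrow> 'a \<Rightarrow> real) \<Rightarrow> 'a list \<Rightarrow> real" where
  "chain_weight n g x = (\<Prod>i<n-1. g i (x ! i) (x ! (i + 1)))"

text \<open>The state space is finite and nonempty, and \<open>n \<ge> 2\<close>, so that there is at least one potential
  and the extremal values \<open>R\<close> and \<open>r\<close> below exist. The potentials are an explicit argument because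
  they are not determined by \<open>\<mu>\<close>, and \<open>R\<close> and \<open>r\<close> depend on their choice.\<close>

definition undirected_markov_chain ::
  "'a set \<Rightarrow> nat \<Rightarrow> (nat \<Rightarrow> 'a \<Rightarrow> 'a \<Rightarrow> real) \<Rightarrow> 'a list pmf \<Rightarrow> bool" where
  "undirected_markov_chain \<Omega> n g \<mu> \<longleftrightarrow>
     finite \<Omega> \<and> \<Omega> \<noteq> {} \<and> 2 \<le> n \<and>
     (\<forall>i<n-1. \<forall>a\<in>\<Omega>. \<forall>b\<in>\<Omega>. 0 < g i a b) \<and>
     set_pmf \<mu> \<subseteq> tuples \<Omega> n \<and>
     (\<forall>x\<in>tuples \<Omega> n. pmf \<mu> x = chain_weight n g x / (\<Sum>x'\<in>tuples \<Omega> n. chain_weight n g x'))"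

definition potential_values :: "'a set \<Rightarrow> nat \<Rightarrow> (nat \<Rightarrow> 'a \<Rightarrow> 'a \<Rightarrow> real) \<Rightarrow> real set" where
  "potential_values \<Omega> n g = {g i a b | i a b. i < n - 1 \<and> a \<in> \<Omega> \<and> b \<in> \<Omega>}"

definition R_max :: "'a set \<Rightarrow> nat \<Rightarrow> (nat \<Rightarrow> 'a \<Rightarrow> 'a \<Rightarrow> real) \<Rightarrow> real" where
  "R_max \<Omega> n g = Max (potential_values \<Omega> n g)"

definition r_min :: "'a set \<Rightarrow> nat \<Rightarrow> (nat \<Rightarrow> 'a \<Rightarrow> 'a \<Rightarrow> real) \<Rightarrow> real" where
  "r_min \<Omega> n g = Min (potential_values \<Omega> n g)"

definition R_bar :: "'a set \<Rightarrow> nat \<Rightarrow> (nat \<Rightarrow> 'a \<Rightarrow> 'a \<Rightarrow> real) \<Rightarrow> real" where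
  "R_bar \<Omega> n g =
     ((R_max \<Omega> n g)\<^sup>2 - (r_min \<Omega> n g)\<^sup>2) / ((R_max \<Omega> n g)\<^sup>2 + (r_min \<Omega> n g)\<^sup>2)"

section \<open>Adaptive queries and statistical accuracy\<close>

definition query_on :: "('a \<Rightarrow> real) \<Rightarrow> 'a list \<Rightarrow> real" where
  "query_on q T = (\<Sum>x\<leftarrow>T. q x) / real (length T)"

definition query_mean :: "('a \<Rightarrow> real) \<Rightarrow> 'a list pmf \<Rightarrow> real" where
  "query_mean q \<mu> = measure_pmf.expectation \<mu> (query_on q)"

text \<open>A mechanism is a randomised process with an internal state: \<open>init\<close> receives the dataset,
  \<open>respond\<close> answers one query and updates the state.\<close>

record ('a, 's) mechanism =
  init :: "'a list \<Rightarrow> 's pmf"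
  respond :: "('a \<Rightarrow> real) \<Rightarrow> 's \<Rightarrow> (real \<times> 's) pmf"

type_synonym 'a transcript = "(('a \<Rightarrow> real) \<times> real) list"

text \<open>An adversary maps the transcript so far (own queries and received answers, oldest first) to
  the possibly randomised choice of the next query.\<close>

type_synonym 'a adversary = "'a transcript \<Rightarrow> ('a \<Rightarrow> real) pmf"

definition valid_adversary :: "'a set \<Rightarrow> 'a adversary \<Rightarrow> bool" where
  "valid_adversary \<Omega> A \<longleftrightarrow> (\<forall>h. \<forall>q\<in>set_pmf (A h). \<forall>x\<in>\<Omega>. 0 \<le> q x \<and> q x \<le> 1)"

primrec play ::
  "('a, 's) mechanism \<Rightarrow> 'a adversary \<Rightarrow> nat \<Rightarrow> 'a transcript \<Rightarrow> 's \<Rightarrow> 'a transcript pmf" where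
  "play M A 0 h s = return_pmf h"
| "play M A (Suc k) h s =
     bind_pmf (A h) (\<lambda>q. bind_pmf (respond M q s) (\<lambda>(a, s'). play M A k (h @ [(q, a)]) s'))"

definition game :: "('a, 's) mechanism \<Rightarrow> 'a adversary \<Rightarrow> nat \<Rightarrow> 'a list \<Rightarrow> 'a transcript pmf" where
  "game M A k S = bind_pmf (init M S) (play M A k [])"

definition statistically_accurate ::
  "('a, 's) mechanism \<Rightarrow> 'a set \<Rightarrow> nat \<Rightarrow> real \<Rightarrow> real \<Rightarrow> 'a list pmf \<Rightarrow> bool" where
  "statistically_accurate M \<Omega> k \<alpha>' \<beta> \<mu> \<longleftrightarrow>
     (\<forall>A. valid_adversary \<Omega> A \<longrightarrow>
        measure_pmf.prob (bind_pmf \<mu> (game M A k))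
          {h. Max ((\<lambda>(q, a). \<bar>query_mean q \<mu> - a\<bar>) ` set h) > \<alpha>'} \<le> \<beta>)"

section \<open>Computationally efficient mechanisms\<close>

text \<open>Efficiency is measured on a uniform randomised real RAM with bounded loops. The machine has an
  indirectly addressable memory of naturals and one of reals, unit-cost exact arithmetic and
  comparison on reals (no rounding, no real constants besides rationals), Bernoulli coins, and an
  oracle that evaluates the current query on the \<open>j\<close>-th data point. Since a loop bound is
  evaluated on entry, every program terminates; this is no restriction for polynomial-time
  computation, which can be clocked. Natural numbers have no multiplication primitive, so they stay
  singly exponential in the running time.\<close>

datatype nexp =
    NConst nat
  | NMem nexp
  | NAdd nexp nexp
  | NSub nexp nexp

datatype rexp =
    RConst rat
  | ROfNat nexp
  | RMem nexp
  | Query nexp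
  | RAdd rexp rexp
  | RSub rexp rexp
  | RMult rexp rexp
  | RDiv rexp rexp

datatype bexp =
    NLess nexp nexp
  | RLess rexp rexp
  | BNot bexp
  | BAnd bexp bexp

datatype cmd =
    Skip
  | NStore nexp nexp
  | RStore nexp rexp
  | Flip nexp rexp
  | Seq cmd cmd
  | Cond bexp cmd cmd
  | Loop nexp cmd

text \<open>The field \<open>clock\<close> counts executed instructions and cannot be read by programs.\<close>

record store =
  nmem :: "nat \<Rightarrow> nat"
  rmem :: "nat \<Rightarrow> real"
  clock :: nat

primrec nval :: "nexp \<Rightarrow> store \<Rightarrow> nat" where
  "nval (NConst c) s = c"
| "nval (NMem e) s = nmem s (nval e s)"
| "nval (NAdd e f) s = nval e s + nval f s"
| "nval (NSub e f) s = nval e s - nval f s"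

primrec rval :: "rexp \<Rightarrow> (nat \<Rightarrow> real) \<Rightarrow> store \<Rightarrow> real" where
  "rval (RConst c) orc s = of_rat c"
| "rval (ROfNat e) orc s = real (nval e s)"
| "rval (RMem e) orc s = rmem s (nval e s)"
| "rval (Query e) orc s = orc (nval e s)"
| "rval (RAdd e f) orc s = rval e orc s + rval f orc s"
| "rval (RSub e f) orc s = rval e orc s - rval f orc s"
| "rval (RMult e f) orc s = rval e orc s * rval f orc s"
| "rval (RDiv e f) orc s = rval e orc s / rval f orc s"

primrec bval :: "bexp \<Rightarrow> (nat \<Rightarrow> real) \<Rightarrow> store \<Rightarrow> bool" where
  "bval (NLess e f) orc s \<longleftrightarrow> nval e s < nval f s"
| "bval (RLess e f) orc s \<longleftrightarrow> rval e orc s < rval f orc s"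
| "bval (BNot b) orc s \<longleftrightarrow> \<not> bval b orc s"
| "bval (BAnd b c) orc s \<longleftrightarrow> bval b orc s \<and> bval c orc s"

definition tick :: "store \<Rightarrow> store" where
  "tick s = s\<lparr>clock := clock s + 1\<rparr>"

text \<open>One unit per instruction suffices, because the size of the expressions in a program is bounded
  by a constant of the program. The parameter of \<open>bernoulli_pmf\<close> is clamped to the unit
  interval.\<close>

primrec exec :: "cmd \<Rightarrow> (nat \<Rightarrow> real) \<Rightarrow> store \<Rightarrow> store pmf" where
  "exec Skip orc s = return_pmf (tick s)"
| "exec (NStore e f) orc s =
     return_pmf (tick (s\<lparr>nmem := (nmem s)(nval e s := nval f s)\<rparr>))"
| "exec (RStore e f) orc s =
     return_pmf (tick (s\<lparr>rmem := (rmem s)(nval e s := rval f orc s)\<rparr>))"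
| "exec (Flip e f) orc s =
     map_pmf (\<lambda>b. tick (s\<lparr>nmem := (nmem s)(nval e s := (if b then 1 else 0))\<rparr>))
       (bernoulli_pmf (rval f orc s))"
| "exec (Seq c d) orc s = bind_pmf (exec c orc s) (exec d orc)"
| "exec (Cond b c d) orc s =
     (if bval b orc s then exec c orc (tick s) else exec d orc (tick s))"
| "exec (Loop e c) orc s =
     ((\<lambda>p. bind_pmf p (\<lambda>s'. exec c orc (tick s'))) ^^ nval e s) (return_pmf (tick s))"

text \<open>Input convention: the sample size and the number of queries are in natural cells 0 and 1, the
  accuracy parameters \<open>\<alpha>\<close> and \<open>\<beta>\<close> in real cells 0 and 1. The program is run once per query; its
  memory persists between queries, and its answer is read from real cell 2.\<close>

definition start :: "nat \<Rightarrow> nat \<Rightarrow> real \<Rightarrow> real \<Rightarrow> store" where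
  "start n k \<alpha> \<beta> =
     \<lparr>nmem = (\<lambda>_. 0)(0 := n, 1 := k), rmem = (\<lambda>_. 0)(0 := \<alpha>, 1 := \<beta>), clock = 0\<rparr>"

definition sample_oracle :: "'a list \<Rightarrow> ('a \<Rightarrow> real) \<Rightarrow> nat \<Rightarrow> real" where
  "sample_oracle S q j = (if j < length S then q (S ! j) else 0)"

definition program_mechanism ::
  "cmd \<Rightarrow> nat \<Rightarrow> real \<Rightarrow> real \<Rightarrow> ('a, 'a list \<times> store) mechanism" where
  "program_mechanism P k \<alpha> \<beta> =
     \<lparr>init = (\<lambda>S. return_pmf (S, start (length S) k \<alpha> \<beta>)),
      respond = (\<lambda>q (S, s). map_pmf (\<lambda>s'. (rmem s' 2, (S, s'))) (exec P (sample_oracle S q) s))\<rparr>"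

primrec run_rounds :: "cmd \<Rightarrow> (nat \<Rightarrow> real) list \<Rightarrow> store \<Rightarrow> store pmf" where
  "run_rounds P [] s = return_pmf s"
| "run_rounds P (orc # orcs) s = bind_pmf (exec P orc s) (run_rounds P orcs)"

text \<open>Total worst-case running time over all \<open>k\<close> rounds, polynomial in \<open>n\<close> and \<open>k\<close>. The bound ranges
  over all coin outcomes and all sequences of oracle tables, so it also covers queries chosen
  adaptively.\<close>

definition polynomial_time :: "cmd \<Rightarrow> bool" where
  "polynomial_time P \<longleftrightarrow>
     (\<exists>c. \<forall>n k \<alpha> \<beta> orcs.
        0 < \<alpha> \<and> 0 < \<beta> \<and> \<beta> < 1 \<and> length orcs = k \<and>
        (\<forall>orc\<in>set orcs. \<forall>j. 0 \<le> orc j \<and> orc j \<le> 1) \<longrightarrow>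
        (\<forall>s\<in>set_pmf (run_rounds P orcs (start n k \<alpha> \<beta>)). clock s \<le> c * (n + k + 1) ^ c))"

section \<open>Sample complexity\<close>

text \<open>Soft-O: \<open>m\<close> is at most \<open>f\<close> times a polylogarithm of \<open>f\<close>, with \<open>exp 1\<close> added to keep the
  logarithm at least 1. The failure probability is bounded away from 1, since the intended \<open>f\<close>
  contains the factor \<open>ln (1 / \<beta>)\<close>, which vanishes as \<open>\<beta>\<close> tends to 1.\<close>

definition soft_O :: "(nat \<Rightarrow> real \<Rightarrow> real \<Rightarrow> nat) \<Rightarrow> (nat \<Rightarrow> real \<Rightarrow> real \<Rightarrow> real) \<Rightarrow> bool" where
  "soft_O m f \<longleftrightarrow>
     (\<forall>\<beta>\<^sub>0. 0 < \<beta>\<^sub>0 \<and> \<beta>\<^sub>0 < 1 \<longrightarrow>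
        (\<exists>C::real. \<exists>c::nat. \<forall>k \<alpha> \<beta>. 1 \<le> k \<and> 0 < \<alpha> \<and> 0 < \<beta> \<and> \<beta> \<le> \<beta>\<^sub>0 \<longrightarrow>
           real (m k \<alpha> \<beta>) \<le> C * f k \<alpha> \<beta> * ln (exp 1 + f k \<alpha> \<beta>) ^ c))"

end

theory Submission
  imports Defs
begin

text \<open>Each query is answered by the frequency of heads among about \<open>n / sqrt k\<close> coins of bias
  \<open>1/4 + q(S)/2\<close>. Replacing one data point moves this bias by at most \<open>1/(2n)\<close>, and the bias stays away
  from 0 and 1, so the joint law of all \<open>k\<close> answers is stable: over about \<open>n sqrt k\<close> coins the squared
  relative changes add up to about \<open>sqrt k / n\<close>, which is at most \<open>\<alpha>\<^sup>2\<close> up to logarithms. A Hoelder-type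
  inequality that composes along the interaction turns this into approximate differential privacy.

  For the accuracy on \<open>\<mu>\<close>, resample coordinate \<open>i\<close> from its conditional law given the other coordinates.
  The two values of the coordinate are exchangeable, stability lets the transcript ignore the exchange,
  and the conditional law is within \<open>R_bar\<close> of the marginal, because only two potentials are involved.
  Thus a query that depends on the transcript has on average about the same value on \<open>S\<close> as on \<open>\<mu>\<close>, up
  to \<open>R_bar\<close>. This is applied to a wrongly answered query, weighted by the indicator of the event that
  there is one.\<close>

section \<open>The coin-flipping program\<close>

text \<open>The sampling noise of the coins is the only noise, so a machine whose randomness
  consists of Bernoulli coins needs no sampler for a noise distribution. The number \<open>N\<close>
  of coins is pulled both ways: accuracy \<alpha> / 2 for all \<open>k\<close> answers wants
  \<open>N\<close> at least about \<open>ln (k / (\<alpha> * \<beta>)) / \<alpha>\<^sup>2\<close>,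
  while each coin adds to the instability. With \<open>N\<close> about \<open>n / sqrt k\<close>,
  both demands are met from \<open>n\<close> of order \<open>sqrt k / \<alpha>\<^sup>2\<close> times
  logarithms. The failure probability \<beta> is reached in one run, without amplification. Let
  \<open>P\<close> be the probability of a wrong answer. On that event a gap of order \<alpha>
  separates sample and mean, so the weighted inequality bounds a multiple of
  \<open>\<alpha> * P\<close> by the additive errors. These must hence be of order
  \<open>\<alpha> * \<beta>\<close>, which fixes the Hoelder exponent: its conjugate
  \<open>b\<close> is about \<open>ln (1 / (\<alpha> * \<beta>)) / \<alpha>\<close>. The total loss
  \<open>b * sqrt k / n\<close> is then at most of order \<alpha>, a multiplicative error that the
  gap can absorb.\<close>

lemma exec_Loop_rel:
  assumes "nval e s = N" "R 0 (tick s) y"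
    and step: "\<And>i s y. R i s y \<Longrightarrow> rel_pmf (R (Suc i)) (exec c orc (tick s)) (F y)"
  shows "rel_pmf (R N) (exec (Loop e c) orc s) (((\<lambda>p. bind_pmf p F) ^^ N) (return_pmf y))"
proof -
  have "rel_pmf (R i) (((\<lambda>p. bind_pmf p (\<lambda>s'. exec c orc (tick s'))) ^^ i) (return_pmf (tick s)))
     (((\<lambda>p. bind_pmf p F) ^^ i) (return_pmf y))" for i
    by (induction i) (auto simp: assms(2) intro: rel_pmf_bindI step)
  then show ?thesis
    using assms(1) by simp
qed

lemma exec_Loop_invariant:
  assumes "s' \<in> set_pmf (exec (Loop e c) orc s)" "nval e s = N" "I 0 (tick s)"
    and step: "\<And>i s s'. I i s \<Longrightarrow> s' \<in> set_pmf (exec c orc (tick s)) \<Longrightarrow> I (Suc i) s'"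
  shows "I N s'"
proof -
  have "\<forall>s'\<in>set_pmf (((\<lambda>p. bind_pmf p (\<lambda>s'. exec c orc (tick s'))) ^^ i) (return_pmf (tick s))). I i s'"
    for i
    by (induction i) (auto simp: assms(3) intro: step)
  then show ?thesis
    using assms(1,2) by simp
qed

text \<open>Serves deterministic prefixes: the states in the support of \<open>p\<close> are fixed
  one at a time while the law on the right stays put.\<close>

lemma rel_pmf_bind_left:
  assumes "\<And>x. x \<in> set_pmf p \<Longrightarrow> rel_pmf R (f x) q"
  shows "rel_pmf R (bind_pmf p f) q"
proof -
  have "rel_pmf (\<lambda>x _. x \<in> set_pmf p) p (return_pmf ())"
    by (simp add: rel_pmf_return_pmf2)
  then have "rel_pmf R (bind_pmf p f) (bind_pmf (return_pmf ()) (\<lambda>_. q))"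
    by (rule rel_pmf_bindI) (rule assms)
  then show ?thesis
    by (simp add: bind_return_pmf)
qed

section \<open>The number of coins\<close>

definition coin_step :: "nat \<Rightarrow> nat \<Rightarrow> nat \<Rightarrow> nat" where
  "coin_step n k N = (if (N + 1)\<^sup>2 * k \<le> n\<^sup>2 then N + 1 else N)"

text \<open>For \<open>1 \<le> k\<close> this is \<open>n / sqrt k\<close> rounded down, found by
  counting upwards because the machine has no square root; \<open>n\<close> trial steps suffice
  since the value is at most \<open>n\<close>.\<close>

definition coin_count :: "nat \<Rightarrow> nat \<Rightarrow> nat" where
  "coin_count n k = (coin_step n k ^^ n) 0"

text \<open>A failed step leaves the candidate unchanged, so every later step fails too; this makes
  the third clause inductive.\<close>

lemma coin_count_invariant:
  fixes n k i :: nat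
  defines "N \<equiv> (coin_step n k ^^ i) 0"
  shows "N \<le> i" and "N\<^sup>2 * k \<le> n\<^sup>2" and "N = i \<or> \<not> (N + 1)\<^sup>2 * k \<le> n\<^sup>2"
proof -
  have "N \<le> i \<and> N\<^sup>2 * k \<le> n\<^sup>2 \<and> (N = i \<or> \<not> (N + 1)\<^sup>2 * k \<le> n\<^sup>2)"
    unfolding N_def
  proof (induction i)
    case (Suc i)
    then show ?case
      unfolding funpow.simps o_apply coin_step_def[of n k "(coin_step n k ^^ i) 0"]
      by (simp split: if_split) blast
  qed simp
  then show "N \<le> i" and "N\<^sup>2 * k \<le> n\<^sup>2" and "N = i \<or> \<not> (N + 1)\<^sup>2 * k \<le> n\<^sup>2"
    by auto
qed

lemma coin_count_le: "coin_count n k \<le> n"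
  unfolding coin_count_def by (rule coin_count_invariant)

lemma coin_count_upper: "(coin_count n k)\<^sup>2 * k \<le> n\<^sup>2"
  unfolding coin_count_def by (rule coin_count_invariant)

lemma coin_count_lower:
  assumes "1 \<le> k"
  shows "n\<^sup>2 < (coin_count n k + 1)\<^sup>2 * k"
proof -
  consider "coin_count n k = n" | "n\<^sup>2 < (coin_count n k + 1)\<^sup>2 * k"
    using coin_count_invariant(3)[where n = n and k = k and i = n] unfolding coin_count_def not_le by blast
  then show ?thesis
  proof cases
    case 1
    have "n\<^sup>2 < (n + 1)\<^sup>2 * 1"
      by (simp add: power2_eq_square)
    also have "\<dots> \<le> (n + 1)\<^sup>2 * k"
      using assms by (intro mult_left_mono) auto
    finally show ?thesis
      using 1 by simp
  qed
qed

text \<open>Natural cells: 2 is a loop counter, 3 the number of coins, 4 the number of heads, 5 the last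
  coin. Real cell 3 holds the sum of the query values and then the bias of the coins.\<close>

abbreviation ncell :: "nat \<Rightarrow> nexp" where
  "ncell i \<equiv> NMem (NConst i)"

abbreviation rcell :: "nat \<Rightarrow> rexp" where
  "rcell i \<equiv> RMem (NConst i)"

definition sum_loop :: cmd where
  "sum_loop = Loop (ncell 0)
     (Seq (RStore (NConst 3) (RAdd (rcell 3) (Query (ncell 2))))
          (NStore (NConst 2) (NAdd (ncell 2) (NConst 1))))"

text \<open>The comparison runs on reals, since naturals cannot be multiplied. \<open>Skip\<close>
  costs a tick like the store, so every iteration takes exactly 3.\<close>

definition count_loop :: cmd where
  "count_loop = Loop (ncell 0)
     (Cond (RLess (RMult (ROfNat (ncell 0)) (ROfNat (ncell 0)))
        (RMult (RMult (ROfNat (NAdd (ncell 3) (NConst 1))) (ROfNat (NAdd (ncell 3) (NConst 1))))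
          (ROfNat (ncell 1))))
        Skip (NStore (NConst 3) (NAdd (ncell 3) (NConst 1))))"

definition flip_loop :: cmd where
  "flip_loop = Loop (ncell 3)
     (Seq (Flip (NConst 5) (rcell 3)) (NStore (NConst 4) (NAdd (ncell 5) (ncell 4))))"

definition coin_program :: cmd where
  "coin_program =
     Seq (Seq (NStore (NConst 2) (NConst 0)) (RStore (NConst 3) (RConst 0)))
    (Seq sum_loop
    (Seq (NStore (NConst 3) (NConst 0))
    (Seq count_loop
    (Seq (Seq (RStore (NConst 3) (RAdd (RConst (1/4))
            (RDiv (RDiv (rcell 3) (ROfNat (ncell 0))) (RConst 2))))
          (NStore (NConst 4) (NConst 0)))
    (Seq flip_loop
      (RStore (NConst 2) (RMult (RConst 2)
         (RSub (RDiv (ROfNat (ncell 4)) (ROfNat (ncell 3))) (RConst (1/4))))))))))"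

lemma sum_loop_correct:
  assumes "s' \<in> set_pmf (exec sum_loop orc s)" "nmem s 2 = 0" "rmem s 3 = 0"
  shows "nmem s' 0 = nmem s 0 \<and> nmem s' 1 = nmem s 1 \<and> rmem s' 3 = (\<Sum>i<nmem s 0. orc i) \<and>
    clock s' = clock s + 1 + 3 * nmem s 0"
proof -
  let ?I = "\<lambda>i s'. nmem s' 0 = nmem s 0 \<and> nmem s' 1 = nmem s 1 \<and> nmem s' 2 = i \<and>
    rmem s' 3 = (\<Sum>j<i. orc j) \<and> clock s' = clock s + 1 + 3 * i"
  have "?I (nmem s 0) s'"
    by (rule exec_Loop_invariant[OF assms(1)[unfolded sum_loop_def], where I = ?I])
       (use assms(2,3) in \<open>auto simp: tick_def bind_return_pmf\<close>)
  then show ?thesis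
    by blast
qed

lemma count_loop_correct:
  assumes "s' \<in> set_pmf (exec count_loop orc s)" "nmem s 3 = 0"
  shows "nmem s' 0 = nmem s 0 \<and> nmem s' 1 = nmem s 1 \<and> rmem s' 3 = rmem s 3 \<and>
    nmem s' 3 = coin_count (nmem s 0) (nmem s 1) \<and> clock s' = clock s + 1 + 3 * nmem s 0"
proof -
  have *: "real n * real n < (1 + real N) * (1 + real N) * real k \<longleftrightarrow> \<not> (N + 1)\<^sup>2 * k \<le> n\<^sup>2"
    for n N k :: nat
  proof -
    have "real n * real n < (1 + real N) * (1 + real N) * real k \<longleftrightarrow>
        real (n * n) < real ((N + 1) * (N + 1) * k)"
      by (simp only: of_nat_mult of_nat_add of_nat_1 add.commute)
    then show ?thesis
      by (simp only: of_nat_less_iff power2_eq_square not_le)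
  qed
  let ?I = "\<lambda>i s'. nmem s' 0 = nmem s 0 \<and> nmem s' 1 = nmem s 1 \<and> rmem s' 3 = rmem s 3 \<and>
    nmem s' 3 = (coin_step (nmem s 0) (nmem s 1) ^^ i) 0 \<and> clock s' = clock s + 1 + 3 * i"
  have "?I (nmem s 0) s'"
  proof (rule exec_Loop_invariant[OF assms(1)[unfolded count_loop_def], where I = ?I])
    fix i t t'
    assume t: "?I i t" and t': "t' \<in> set_pmf (exec (Cond (RLess (RMult (ROfNat (ncell 0)) (ROfNat (ncell 0)))
        (RMult (RMult (ROfNat (NAdd (ncell 3) (NConst 1))) (ROfNat (NAdd (ncell 3) (NConst 1))))
          (ROfNat (ncell 1)))) Skip (NStore (NConst 3) (NAdd (ncell 3) (NConst 1)))) orc (tick t))"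
    show "?I (Suc i) t'"
    proof (cases "(nmem t 3 + 1)\<^sup>2 * nmem s 1 \<le> (nmem s 0)\<^sup>2")
      case True
      then show ?thesis
        using t t' *[of "nmem s 0" "nmem t 3" "nmem s 1"]
        by (simp add: tick_def coin_step_def add.commute)
    next
      case False
      then show ?thesis
        using t t' *[of "nmem s 0" "nmem t 3" "nmem s 1"]
        by (simp add: tick_def coin_step_def add.commute)
    qed
  qed (use assms(2) in \<open>simp_all add: tick_def\<close>)
  then show ?thesis
    unfolding coin_count_def by blast
qed

text \<open>\<open>binomial_pmf_Suc\<close> draws the new coin first, the loop draws it last; the
  draws commute.\<close>

lemma binomial_pmf_iterate:
  assumes "0 \<le> p" "p \<le> 1"
  shows "((\<lambda>r. bind_pmf r (\<lambda>c. map_pmf (\<lambda>b. of_bool b + c) (bernoulli_pmf p))) ^^ N) (return_pmf 0)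
    = binomial_pmf N p"
proof (induction N)
  case 0
  then show ?case
    using assms by (simp add: binomial_pmf_0)
next
  case (Suc N)
  then show ?case
    using assms
    by (simp add: binomial_pmf_Suc map_pmf_def)
       (subst bind_commute_pmf, simp add: of_bool_def)
qed

lemma flip_loop_correct:
  assumes "nmem s 4 = 0" "rmem s 3 = p" "0 \<le> p" "p \<le> 1"
  shows "rel_pmf (\<lambda>s' c. nmem s' 0 = nmem s 0 \<and> nmem s' 1 = nmem s 1 \<and> nmem s' 3 = nmem s 3 \<and>
      nmem s' 4 = c \<and> clock s' = clock s + 1 + 3 * nmem s 3)
    (exec flip_loop orc s) (binomial_pmf (nmem s 3) p)"
  unfolding flip_loop_def binomial_pmf_iterate[OF assms(3,4), symmetric]
  by (rule pmf.rel_mono_strong[OF exec_Loop_rel[where N = "nmem s 3" and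
      R = "\<lambda>i s' c. nmem s' 0 = nmem s 0 \<and> nmem s' 1 = nmem s 1 \<and> nmem s' 3 = nmem s 3 \<and>
       rmem s' 3 = p \<and> nmem s' 4 = c \<and> clock s' = clock s + 1 + 3 * i"]])
    (use assms in \<open>auto simp: tick_def bind_map_pmf map_pmf_def[symmetric]
      pmf.rel_map o_def intro!: rel_pmf_reflI\<close>)

definition oracle_mean :: "nat \<Rightarrow> (nat \<Rightarrow> real) \<Rightarrow> real" where
  "oracle_mean n orc = (\<Sum>i<n. orc i) / real n"

lemma oracle_mean_bounds:
  assumes "\<And>j. 0 \<le> orc j \<and> orc j \<le> 1"
  shows "0 \<le> oracle_mean n orc" "oracle_mean n orc \<le> 1"
proof -
  have "(\<Sum>i<n. orc i) \<le> (\<Sum>i<n. 1)"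
    using assms by (intro sum_mono) auto
  then show "oracle_mean n orc \<le> 1"
    by (auto simp: oracle_mean_def divide_simps)
  show "0 \<le> oracle_mean n orc"
    using assms by (auto simp: oracle_mean_def intro!: divide_nonneg_nonneg sum_nonneg)
qed

text \<open>Inverse of the bias map \<open>v \<mapsto> 1/4 + v / 2\<close>, applied to the frequency
  of heads. With no coins at all, division by 0 makes the answer -1/2.\<close>

definition coin_answer :: "nat \<Rightarrow> nat \<Rightarrow> nat \<Rightarrow> real" where
  "coin_answer n k c = 2 * (real c / real (coin_count n k) - 1 / 4)"

text \<open>Memory persists between queries, so the hypotheses fix only natural cells 0 and 1; every
  other cell that the program reads is written first. Coupling the final store with the head count
  gives the law of the answer and the clock bound at once.\<close>

lemma coin_program_correct:
  assumes orc: "\<And>j. 0 \<le> orc j \<and> orc j \<le> 1"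
    and n: "nmem s 0 = n" and k: "nmem s 1 = k"
  shows "rel_pmf (\<lambda>s' c. nmem s' 0 = n \<and> nmem s' 1 = k \<and> rmem s' 2 = coin_answer n k c \<and>
      clock s' \<le> clock s + 9 * n + 9)
    (exec coin_program orc s) (binomial_pmf (coin_count n k) (1/4 + oracle_mean n orc / 2))"
proof -
  let ?p = "1/4 + oracle_mean n orc / 2" and ?N = "coin_count n k"
  let ?c1 = "Seq (NStore (NConst 2) (NConst 0)) (RStore (NConst 3) (RConst 0))"
  let ?c2 = "Seq (RStore (NConst 3) (RAdd (RConst (1/4))
     (RDiv (RDiv (rcell 3) (ROfNat (ncell 0))) (RConst 2)))) (NStore (NConst 4) (NConst 0))"
  let ?c3 = "RStore (NConst 2) (RMult (RConst 2)
         (RSub (RDiv (ROfNat (ncell 4)) (ROfNat (ncell 3))) (RConst (1/4))))"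
  have p: "0 \<le> ?p" "?p \<le> 1"
    using oracle_mean_bounds[of orc n, OF orc] by auto
  show ?thesis
    unfolding coin_program_def exec.simps(5)[where c = ?c1] exec.simps(5)[where c = sum_loop]
      exec.simps(5)[where c = "NStore (NConst 3) (NConst 0)"]
      exec.simps(5)[where c = count_loop] exec.simps(5)[where c = ?c2]
  \<comment> \<open>Everything before \<open>flip_loop\<close> is deterministic, so
    \<open>s1\<close> to \<open>s5\<close> are determined by support facts and only the flips are
    coupled.\<close>
  proof (intro rel_pmf_bind_left)
    fix s1 s2 s3 s4 s5
    assume s1: "s1 \<in> set_pmf (exec ?c1 orc s)" and s2: "s2 \<in> set_pmf (exec sum_loop orc s1)"
      and s3: "s3 \<in> set_pmf (exec (NStore (NConst 3) (NConst 0)) orc s2)"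
      and s4: "s4 \<in> set_pmf (exec count_loop orc s3)" and s5: "s5 \<in> set_pmf (exec ?c2 orc s4)"
    have 1: "nmem s1 0 = n \<and> nmem s1 1 = k \<and> nmem s1 2 = 0 \<and> rmem s1 3 = 0 \<and> clock s1 = clock s + 2"
      using s1 n k by (auto simp: tick_def bind_return_pmf)
    have 2: "nmem s2 0 = n \<and> nmem s2 1 = k \<and> rmem s2 3 = (\<Sum>i<n. orc i) \<and>
       clock s2 = clock s + 3 + 3 * n"
      using sum_loop_correct[OF s2] 1 by auto
    have 3: "nmem s3 0 = n \<and> nmem s3 1 = k \<and> rmem s3 3 = (\<Sum>i<n. orc i) \<and> nmem s3 3 = 0 \<and>
       clock s3 = clock s + 4 + 3 * n"
      using s3 2 by (auto simp: tick_def)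
    have 4: "nmem s4 0 = n \<and> nmem s4 1 = k \<and> rmem s4 3 = (\<Sum>i<n. orc i) \<and> nmem s4 3 = ?N \<and>
       clock s4 = clock s + 5 + 6 * n"
      using count_loop_correct[OF s4] 3 by auto
    have 5: "nmem s5 0 = n \<and> nmem s5 1 = k \<and> rmem s5 3 = ?p \<and> nmem s5 3 = ?N \<and> nmem s5 4 = 0 \<and>
       clock s5 = clock s + 7 + 6 * n"
      using s5 4 by (auto simp: tick_def bind_return_pmf oracle_mean_def of_rat_divide)
    have "rel_pmf (\<lambda>s' c. nmem s' 0 = n \<and> nmem s' 1 = k \<and> rmem s' 2 = coin_answer n k c \<and>
        clock s' \<le> clock s + 9 * n + 9)
      (bind_pmf (exec flip_loop orc s5) (exec ?c3 orc))
      (bind_pmf (binomial_pmf (nmem s5 3) ?p) return_pmf)"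
      by (rule rel_pmf_bindI[OF flip_loop_correct])
         (use 5 p coin_count_le[of n k] in \<open>auto simp: tick_def coin_answer_def of_rat_divide\<close>)
    then show "rel_pmf (\<lambda>s' c. nmem s' 0 = n \<and> nmem s' 1 = k \<and> rmem s' 2 = coin_answer n k c \<and>
        clock s' \<le> clock s + 9 * n + 9)
      (exec (Seq flip_loop ?c3) orc s5) (binomial_pmf ?N ?p)"
      using 5 by (simp add: bind_return_pmf')
  qed
qed

lemma coin_program_polynomial_time: "polynomial_time coin_program"
proof -
  have clock: "s' \<in> set_pmf (run_rounds coin_program orcs s) \<Longrightarrow>
      \<forall>orc\<in>set orcs. \<forall>j. 0 \<le> orc j \<and> orc j \<le> 1 \<Longrightarrow>
      clock s' \<le> clock s + length orcs * (9 * nmem s 0 + 9)" for orcs s s'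
  proof (induction orcs arbitrary: s)
    case (Cons orc orcs)
    then obtain s1 where s1: "s1 \<in> set_pmf (exec coin_program orc s)"
      and s': "s' \<in> set_pmf (run_rounds coin_program orcs s1)"
      by auto
    have "nmem s1 0 = nmem s 0 \<and> clock s1 \<le> clock s + 9 * nmem s 0 + 9"
      using rel_pmf_imp_rel_set[OF coin_program_correct[OF _ refl refl, of orc s]] s1 Cons.prems(2)
      by (fastforce simp: rel_set_def)
    then show ?case
      using Cons.IH[OF s'] Cons.prems(2) by auto
  qed auto
  show ?thesis
    unfolding polynomial_time_def
  \<comment> \<open>The same number is factor and exponent in \<open>polynomial_time\<close>: 9 is
    the factor obtained here, and the exponent 2 is raised to match it.\<close>
  proof (intro exI[of _ 9] allI impI ballI, elim conjE)
    fix n k :: nat and \<alpha> \<beta> :: real and orcs s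
    assume *: "length orcs = k" "\<forall>orc\<in>set orcs. \<forall>j. 0 \<le> orc j \<and> orc j \<le> 1"
      "s \<in> set_pmf (run_rounds coin_program orcs (start n k \<alpha> \<beta>))"
    have "clock s \<le> 9 * (k * (n + 1))"
      using clock[OF *(3,2)] *(1) by (simp add: start_def algebra_simps)
    also have "k * (n + 1) \<le> (n + k + 1) * (n + k + 1)"
      by (intro mult_mono) auto
    also have "9 * ((n + k + 1) * (n + k + 1)) = 9 * (n + k + 1) ^ 2"
      by (simp add: power2_eq_square)
    also have "\<dots> \<le> 9 * (n + k + 1) ^ 9"
      by (intro mult_left_mono power_increasing) auto
    finally show "clock s \<le> 9 * (n + k + 1) ^ 9"
      by simp
  qed
qed

section \<open>Forgetting the machine state\<close>

definition coin_law :: "nat \<Rightarrow> nat \<Rightarrow> real \<Rightarrow> real pmf" where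
  "coin_law n k v = map_pmf (coin_answer n k) (binomial_pmf (coin_count n k) (1/4 + v / 2))"

text \<open>Answers are drawn afresh from a law that depends on the query alone. Without the state,
  which contains the dataset, runs on two neighbouring datasets can be compared round by
  round.\<close>

primrec stateless_play ::
  "(('a \<Rightarrow> real) \<Rightarrow> real pmf) \<Rightarrow> 'a adversary \<Rightarrow> nat \<Rightarrow> 'a transcript \<Rightarrow> 'a transcript pmf" where
  "stateless_play L A 0 h = return_pmf h"
| "stateless_play L A (Suc j) h =
     bind_pmf (A h) (\<lambda>q. bind_pmf (L q) (\<lambda>a. stateless_play L A j (h @ [(q, a)])))"

text \<open>By \<open>coin_program_correct\<close> the store influences an answer only through
  natural cells 0 and 1, hence the induction over arbitrary \<open>s\<close>.\<close>

lemma play_coin_program: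
  assumes S: "set S \<subseteq> \<Omega>" and A: "valid_adversary \<Omega> A"
    and "nmem s 0 = length S" "nmem s 1 = k"
  shows "play (program_mechanism coin_program k \<alpha> \<beta>) A j h (S, s) =
    stateless_play (\<lambda>q. coin_law (length S) k (query_on q S)) A j h"
  using assms(3,4)
proof (induction j arbitrary: h s)
  case (Suc j)
  let ?n = "length S"
  have "bind_pmf (exec coin_program (sample_oracle S q) s)
      (\<lambda>s'. play (program_mechanism coin_program k \<alpha> \<beta>) A j (h @ [(q, rmem s' 2)]) (S, s')) =
    bind_pmf (binomial_pmf (coin_count ?n k) (1/4 + query_on q S / 2))
      (\<lambda>c. stateless_play (\<lambda>q. coin_law ?n k (query_on q S)) A j (h @ [(q, coin_answer ?n k c)]))"
    if q: "q \<in> set_pmf (A h)" for q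
  proof -
    have "0 \<le> sample_oracle S q j \<and> sample_oracle S q j \<le> 1" for j
      using q A S nth_mem[of j S] unfolding valid_adversary_def sample_oracle_def
      by (auto simp del: nth_mem)
    moreover have "oracle_mean ?n (sample_oracle S q) = query_on q S"
      by (simp add: oracle_mean_def query_on_def sample_oracle_def sum_list_sum_nth atLeast0LessThan)
    ultimately have "rel_pmf (\<lambda>s' c. nmem s' 0 = ?n \<and> nmem s' 1 = k \<and> rmem s' 2 = coin_answer ?n k c \<and>
          clock s' \<le> clock s + 9 * ?n + 9)
        (exec coin_program (sample_oracle S q) s)
        (binomial_pmf (coin_count ?n k) (1/4 + query_on q S / 2))"
      using coin_program_correct[of "sample_oracle S q" s ?n k] Suc.prems by simp
    then show ?thesis
      unfolding pmf.rel_eq[symmetric]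
      by (rule rel_pmf_bindI) (auto simp: pmf.rel_eq Suc.IH)
  qed
  then show ?case
    by (auto simp: program_mechanism_def coin_law_def bind_map_pmf intro!: bind_pmf_cong)
qed simp

lemma game_coin_program:
  assumes "set S \<subseteq> \<Omega>" "valid_adversary \<Omega> A"
  shows "game (program_mechanism coin_program k \<alpha> \<beta>) A k S =
    stateless_play (\<lambda>q. coin_law (length S) k (query_on q S)) A k []"
  using play_coin_program[OF assms, of "start (length S) k \<alpha> \<beta>" k \<alpha> \<beta> k "[]"]
  by (simp add: game_def program_mechanism_def bind_return_pmf start_def)

section \<open>Stability of adaptive coin flips\<close>

lemma integrable_pmf_bounded:
  fixes f :: "'a \<Rightarrow> real"
  assumes "\<And>x. 0 \<le> f x \<and> f x \<le> B"
  shows "integrable (measure_pmf p) f"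
  by (rule measure_pmf.integrable_const_bound[where B = B]) (use assms in \<open>auto intro!: AE_I2\<close>)

lemma expectation_pmf_le:
  fixes f g :: "'a \<Rightarrow> real"
  assumes "\<And>x. 0 \<le> f x \<and> f x \<le> B" "\<And>x. 0 \<le> g x \<and> g x \<le> B'"
    and "\<And>x. x \<in> set_pmf p \<Longrightarrow> f x \<le> g x"
  shows "measure_pmf.expectation p f \<le> measure_pmf.expectation p g"
  by (rule integral_mono_AE[OF integrable_pmf_bounded[OF assms(1)] integrable_pmf_bounded[OF assms(2)]])
     (use assms(3) in \<open>simp add: AE_measure_pmf_iff\<close>)

lemma expectation_pmf_bounds:
  fixes f :: "'a \<Rightarrow> real"
  assumes "\<And>x. 0 \<le> f x \<and> f x \<le> B"
  shows "0 \<le> measure_pmf.expectation p f" "measure_pmf.expectation p f \<le> B"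
proof -
  have "0 \<le> B" using assms[of undefined] by linarith
  show "0 \<le> measure_pmf.expectation p f"
    by (rule integral_nonneg_AE) (use assms in auto)
  show "measure_pmf.expectation p f \<le> B"
    using expectation_pmf_le[of f B "\<lambda>_. B" B p] assms \<open>0 \<le> B\<close> by simp
qed

lemma expectation_bind_pmf:
  fixes f :: "'b \<Rightarrow> real"
  assumes f: "\<And>x. 0 \<le> f x \<and> f x \<le> B"
  shows "measure_pmf.expectation (bind_pmf p K) f =
    measure_pmf.expectation p (\<lambda>x. measure_pmf.expectation (K x) f)"
proof -
  have ennreal: "ennreal (measure_pmf.expectation q g) = (\<integral>\<^sup>+x. g x \<partial>q)"
    if "\<And>x. 0 \<le> g x \<and> g x \<le> B" for q and g :: "'c \<Rightarrow> real"
    by (rule nn_integral_eq_integral[symmetric, OF integrable_pmf_bounded[OF that]])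
       (use that in auto)
  have "ennreal (measure_pmf.expectation (bind_pmf p K) f) =
     (\<integral>\<^sup>+x. ennreal (measure_pmf.expectation (K x) f) \<partial>p)"
    by (simp add: ennreal f)
  also have "\<dots> = ennreal (measure_pmf.expectation p (\<lambda>x. measure_pmf.expectation (K x) f))"
    by (rule ennreal[symmetric]) (use expectation_pmf_bounds[of f B] f in blast)
  finally show ?thesis
    by (subst (asm) ennreal_inj) (auto intro!: integral_nonneg_AE simp: f)
qed

lemma prob_bind_pmf_le:
  assumes "measure_pmf.prob p B \<le> d" "0 \<le> c"
    and "\<And>x. x \<in> set_pmf p \<Longrightarrow> x \<notin> B \<Longrightarrow> measure_pmf.prob (K x) A \<le> c"
  shows "measure_pmf.prob (bind_pmf p K) A \<le> d + c"
proof -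
  have "measure_pmf.prob (bind_pmf p K) A =
      measure_pmf.expectation p (\<lambda>x. measure_pmf.prob (K x) A)"
    using expectation_bind_pmf[of "indicator A" 1 p K] by (simp add: indicator_def)
  also have "\<dots> \<le> measure_pmf.expectation p (\<lambda>x. indicator B x + c)"
    by (rule expectation_pmf_le[of _ 1 _ "1 + c"])
       (use assms in \<open>auto simp: indicator_def intro: order_trans[OF measure_pmf.prob_le_1]\<close>)
  also have "\<dots> = measure_pmf.prob p B + c"
    by (subst Bochner_Integration.integral_add)
       (auto intro: integrable_pmf_bounded[where B = 1] simp: indicator_def)
  finally show ?thesis
    using assms(1) by linarith
qed

text \<open>For the density \<open>X\<close> of \<open>P\<close> with respect to \<open>Q\<close> and the exponent \<open>b\<close> conjugate to \<open>a\<close>, this is the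
  bound \<open>E\<^sub>Q X\<^sup>b \<le> D\<^sup>b\<^sup>-\<^sup>1\<close> on a Renyi divergence, read through Hoelder's inequality. In this form it
  composes along adaptive interactions without mentioning densities.\<close>

definition holder_close :: "real \<Rightarrow> real \<Rightarrow> 'a pmf \<Rightarrow> 'a pmf \<Rightarrow> bool" where
  "holder_close a D P Q \<longleftrightarrow>
     (\<forall>u. (\<forall>x. 0 \<le> u x \<and> u x \<le> 1) \<longrightarrow>
        measure_pmf.expectation P u powr a \<le> D * measure_pmf.expectation Q (\<lambda>x. u x powr a))"

lemma holder_closeD:
  assumes "holder_close a D P Q" "\<And>x. 0 \<le> u x \<and> u x \<le> 1"
  shows "measure_pmf.expectation P u powr a \<le> D * measure_pmf.expectation Q (\<lambda>x. u x powr a)"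
  using assms unfolding holder_close_def by simp

lemma powr_unit_interval:
  fixes x a :: real
  assumes "0 \<le> x \<and> x \<le> 1" "0 < a"
  shows "0 \<le> x powr a \<and> x powr a \<le> 1"
  using assms powr_mono2[of a x 1] by simp

text \<open>The inner expectation under \<open>K\<close> is itself a test function with values in
  the unit interval, so the two hypotheses apply in turn. Inner closeness is asked for on the
  support of \<open>Q\<close>, because it is used after the outer expectation has moved to
  \<open>Q\<close>.\<close>

lemma holder_close_bind:
  assumes P: "holder_close a D P Q" and a: "0 < a" and "0 \<le> D" "0 \<le> E"
    and K: "\<And>x. x \<in> set_pmf Q \<Longrightarrow> holder_close a E (K x) (L x)"
  shows "holder_close a (D * E) (bind_pmf P K) (bind_pmf Q L)"
  unfolding holder_close_def
proof (intro allI impI)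
  fix u :: "'b \<Rightarrow> real" assume u: "\<forall>x. 0 \<le> u x \<and> u x \<le> 1"
  let ?w = "\<lambda>x. measure_pmf.expectation (K x) u"
  let ?v = "\<lambda>x. measure_pmf.expectation (L x) (\<lambda>y. u y powr a)"
  have w: "0 \<le> ?w x \<and> ?w x \<le> 1" for x
    by (intro conjI expectation_pmf_bounds) (use u in auto)
  have ua: "0 \<le> u x powr a \<and> u x powr a \<le> 1" for x
    by (rule powr_unit_interval) (use u a in auto)
  have v: "0 \<le> ?v x \<and> ?v x \<le> 1" for x
    by (intro conjI expectation_pmf_bounds[where f = "\<lambda>y. u y powr a", OF ua])
  have "measure_pmf.expectation (bind_pmf P K) u powr a = measure_pmf.expectation P ?w powr a"
    by (subst expectation_bind_pmf[where B = 1]) (simp_all add: u)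
  also have "\<dots> \<le> D * measure_pmf.expectation Q (\<lambda>x. ?w x powr a)"
    by (rule holder_closeD[OF P w])
  also have "\<dots> \<le> D * measure_pmf.expectation Q (\<lambda>x. E * ?v x)"
  proof (intro mult_left_mono expectation_pmf_le[of _ 1 _ E])
    show "0 \<le> E * ?v x \<and> E * ?v x \<le> E" for x
      using v[of x] \<open>0 \<le> E\<close> by (simp add: mult_left_le)
    show "?w x powr a \<le> E * ?v x" if "x \<in> set_pmf Q" for x
      by (rule holder_closeD[OF K[OF that]]) (use u in auto)
    show "0 \<le> ?w x powr a \<and> ?w x powr a \<le> 1" for x
      by (rule powr_unit_interval[OF w a])
  qed (fact \<open>0 \<le> D\<close>)
  also have "\<dots> = D * E * measure_pmf.expectation (bind_pmf Q L) (\<lambda>x. u x powr a)"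
    by (subst expectation_bind_pmf[where f = "\<lambda>x. u x powr a" and B = 1, OF ua]) simp
  finally show "measure_pmf.expectation (bind_pmf P K) u powr a
      \<le> D * E * measure_pmf.expectation (bind_pmf Q L) (\<lambda>x. u x powr a)" .
qed

lemma holder_close_map:
  assumes "holder_close a D P Q"
  shows "holder_close a D (map_pmf f P) (map_pmf f Q)"
  using assms unfolding holder_close_def by (auto simp: o_def)

text \<open>Jensen's inequality for \<open>x powr a\<close>. It covers the steps that both sides
  share, such as the adversary's choice of a query.\<close>

lemma holder_close_refl:
  assumes "1 < a"
  shows "holder_close a 1 P P"
  unfolding holder_close_def
proof (intro allI impI)
  fix u :: "'a \<Rightarrow> real" assume u: "\<forall>x. 0 \<le> u x \<and> u x \<le> 1"
  let ?s = "measure_pmf.expectation P u" and ?m = "measure_pmf.expectation P (\<lambda>x. u x powr a)"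
  define b where "b = a / (a - 1)"
  have b: "1 < b" "1 / a + 1 / b = 1"
    using assms by (auto simp: b_def divide_simps)
  have ua: "0 \<le> u x powr a \<and> u x powr a \<le> 1" for x
    by (rule powr_unit_interval) (use u assms in auto)
  have s: "0 \<le> ?s"
    by (rule expectation_pmf_bounds(1)[where B = 1]) (use u in auto)
  have m: "0 \<le> ?m"
    by (rule expectation_pmf_bounds(1)[where B = 1, OF ua])
  show "?s powr a \<le> 1 * ?m"
  proof (cases "?s = 0")
    case False
    \<comment> \<open>For this \<open>?t\<close> Young's inequality is an equality at
      \<open>u x = ?s\<close>, so averaging it is the tangent-line proof of Jensen;
      \<open>?t powr b = ?s powr a\<close> lets the second term be absorbed.\<close>
    let ?t = "?s powr (a - 1)"
    have "(a - 1) * b = a"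
      using assms by (simp add: b_def)
    then have t: "0 \<le> ?t" "?t powr b = ?s powr a"
      by (simp_all add: powr_powr)
    have st: "?s * ?t = ?s powr a"
      using powr_add[of ?s 1 "a - 1"] s by simp
    have "?s * ?t = measure_pmf.expectation P (\<lambda>x. u x * ?t)"
      by simp
    also have "\<dots> \<le> measure_pmf.expectation P (\<lambda>x. u x powr a / a + ?t powr b / b)"
    proof (rule expectation_pmf_le[of _ ?t _ "1 + ?t powr b / b"])
      show "u x * ?t \<le> u x powr a / a + ?t powr b / b" for x
        by (rule Youngs_inequality) (use u b assms in auto)
      show "0 \<le> u x * ?t \<and> u x * ?t \<le> ?t" for x
        using u mult_left_le_one_le[of ?t "u x"] by simp
      show "0 \<le> u x powr a / a + ?t powr b / b \<and> u x powr a / a + ?t powr b / b \<le> 1 + ?t powr b / b" for x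
      proof -
        have "0 \<le> u x powr a / a \<and> u x powr a / a \<le> 1"
          using ua[of x] assms by (simp add: divide_le_eq)
        moreover have "0 \<le> ?t powr b / b"
          using b by simp
        ultimately show ?thesis by linarith
      qed
    qed
    also have "\<dots> = ?m / a + ?s powr a / b"
      by (subst Bochner_Integration.integral_add)
         (simp_all add: t(2) integrable_pmf_bounded[where B = 1] ua)
    finally have "?s powr a * (1 - 1 / b) \<le> ?m / a"
      unfolding st by (simp add: right_diff_distrib)
    moreover have "1 - 1 / b = 1 / a"
      using b by linarith
    ultimately have "?s powr a / a \<le> ?m / a"
      by (simp only: times_divide_eq_right mult_1_right)
    then show ?thesis
      using assms by (simp add: divide_le_cancel)
  qed (use m assms in simp)
qed

text \<open>For negative \<open>x\<close>, \<open>(1 + x + x^2) * (1 - x) = 1 - x^3\<close> is at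
  least 1, and \<open>1 - x \<le> exp (- x)\<close>.\<close>

lemma exp_le_quadratic:
  fixes x :: real
  assumes "\<bar>x\<bar> \<le> 1"
  shows "exp x \<le> 1 + x + x\<^sup>2"
proof (cases "0 \<le> x")
  case True
  then show ?thesis using exp_bound[of x] assms by auto
next
  case False
  have "0 \<le> (- x) * x\<^sup>2"
    using False by (intro mult_nonneg_nonneg) auto
  then have "1 \<le> (1 + x + x\<^sup>2) * (1 - x)"
    by (simp add: algebra_simps power2_eq_square)
  also have "\<dots> \<le> (1 + x + x\<^sup>2) * exp (- x)"
  proof (rule mult_left_mono)
    show "0 \<le> 1 + x + x\<^sup>2"
      using assms zero_le_power2[of x] by linarith
  qed (use exp_ge_add_one_self[of "- x"] in simp)
  finally show ?thesis
    by (simp add: exp_minus divide_simps)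
qed

text \<open>With \<open>d = p / q - 1\<close> on heads and \<open>e\<close> on tails, the density \<open>1 + d\<close> has mean 1, so its \<open>b\<close>-th moment
  is at most \<open>E (exp (b * d)) \<le> 1 + b\<^sup>2 * E (d\<^sup>2)\<close>: the linear term cancels.\<close>

lemma holder_close_bernoulli:
  assumes p: "1/4 \<le> p" "p \<le> 3/4" and q: "1/4 \<le> q" "q \<le> 3/4" and pq: "\<bar>p - q\<bar> \<le> \<eta> / 4"
    and b: "2 \<le> b" "b * \<eta> \<le> 1"
  shows "holder_close (b / (b - 1)) (exp (b * \<eta>\<^sup>2) powr (b / (b - 1))) (bernoulli_pmf p) (bernoulli_pmf q)"
  unfolding holder_close_def
proof (intro allI impI)
  fix u :: "bool \<Rightarrow> real" assume u: "\<forall>x. 0 \<le> u x \<and> u x \<le> 1"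
  define a where "a = b / (b - 1)"
  have a: "1 < a" "1 / a + 1 / b = 1"
    using b by (auto simp: a_def divide_simps)
  define m where "m = q * u True powr a + (1 - q) * u False powr a"
  define d e where "d = p / q - 1" and "e = (1 - p) / (1 - q) - 1"
  have "\<bar>d\<bar> = \<bar>p - q\<bar> / q" "\<bar>e\<bar> = \<bar>p - q\<bar> / (1 - q)"
    using q by (auto simp: d_def e_def diff_divide_distrib[symmetric] divide_simps)
  \<comment> \<open>This is why the biases stay at least 1/4 away from 0 and 1: relative changes are
    at most four times the absolute ones.\<close>
  moreover have "\<bar>p - q\<bar> / r \<le> \<eta>" if "1/4 \<le> r" for r
  proof -
    have "\<eta> / 4 \<le> \<eta> * r"
      using that pq mult_left_mono[of "1/4" r \<eta>] abs_ge_zero[of "p - q"] by (simp del: abs_ge_zero)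
    then show ?thesis
      using that pq by (simp add: divide_le_eq)
  qed
  ultimately have de: "\<bar>d\<bar> \<le> \<eta>" "\<bar>e\<bar> \<le> \<eta>"
    using q by auto
  have mean0: "q * d + (1 - q) * e = 0"
    using q by (simp add: d_def e_def field_simps)
  have moment: "(1 + x) powr b \<le> 1 + b * x + b\<^sup>2 * \<eta>\<^sup>2" if "\<bar>x\<bar> \<le> \<eta>" "0 < 1 + x" for x
  proof -
    have "\<bar>b * x\<bar> \<le> b * \<eta>"
      using that b by (simp add: abs_mult mult_left_mono)
    then have bx: "\<bar>b * x\<bar> \<le> 1" "(b * x)\<^sup>2 \<le> (b * \<eta>)\<^sup>2"
      using b by (auto simp: abs_le_square_iff[symmetric])
    have "(1 + x) powr b \<le> exp x powr b"
      using that b by (intro powr_mono2) auto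
    also have "\<dots> = exp (b * x)"
      by (simp add: powr_def mult.commute)
    also have "\<dots> \<le> 1 + b * x + b\<^sup>2 * \<eta>\<^sup>2"
      using exp_le_quadratic[OF bx(1)] bx(2) by (simp add: power_mult_distrib)
    finally show ?thesis .
  qed
  have pos: "0 < 1 + d" "0 < 1 + e"
    using p q by (auto simp: d_def e_def divide_simps)
  define K where "K = q * (1 + d) powr b + (1 - q) * (1 + e) powr b"
  have "K \<le> q * (1 + b * d + b\<^sup>2 * \<eta>\<^sup>2) + (1 - q) * (1 + b * e + b\<^sup>2 * \<eta>\<^sup>2)"
    unfolding K_def using moment[OF de(1) pos(1)] moment[OF de(2) pos(2)] q
    by (intro add_mono mult_left_mono) auto
  also have "\<dots> = 1 + b\<^sup>2 * \<eta>\<^sup>2 + b * (q * d + (1 - q) * e)"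
    by (simp add: algebra_simps)
  finally have K: "K \<le> 1 + b\<^sup>2 * \<eta>\<^sup>2"
    using mean0 by simp
  have m: "0 \<le> m"
    unfolding m_def using q by (intro add_nonneg_nonneg mult_nonneg_nonneg) auto
  define s where "s = p * u True + (1 - p) * u False"
  have "s powr a \<le> exp (b * \<eta>\<^sup>2) powr a * m"
  proof (cases "m = 0")
    case True
    then have "u True = 0" "u False = 0"
      using q unfolding m_def by (auto simp: add_nonneg_eq_0_iff)
    then show ?thesis
      using m by (simp add: s_def)
  next
    case False
    \<comment> \<open>Normalised Young in place of Hoelder: since \<open>?t powr b = m\<close>, both
      terms of the bound are multiples of \<open>m\<close>, and dividing by \<open>?t\<close> leaves
      \<open>m powr (1 / a)\<close>. Hence the separate case \<open>m = 0\<close>.\<close>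
    let ?t = "m powr (1 / b)"
    have t: "?t powr b = m"
      using m b by (simp add: powr_powr)
    have y: "u x * ((1 + r) * ?t) \<le> u x powr a / a + (1 + r) powr b * m / b" if "0 < 1 + r" for x r
      using Youngs_inequality[of a b "u x" "(1 + r) * ?t"] a b u t that by (simp add: powr_mult)
    have "s * ?t = q * (u True * ((1 + d) * ?t)) + (1 - q) * (u False * ((1 + e) * ?t))"
    proof -
      have "q * (1 + d) = p" "(1 - q) * (1 + e) = 1 - p"
        using q by (auto simp: d_def e_def)
      then have "s * ?t = ((q * (1 + d)) * u True + ((1 - q) * (1 + e)) * u False) * ?t"
        by (simp add: s_def)
      then show ?thesis
        by (simp only: algebra_simps)
    qed
    also have "\<dots> \<le> q * (u True powr a / a + (1 + d) powr b * m / b) +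
        (1 - q) * (u False powr a / a + (1 + e) powr b * m / b)"
      using y pos q by (intro add_mono mult_left_mono) auto
    also have "\<dots> = (q * u True powr a + (1 - q) * u False powr a) / a +
        m * (q * (1 + d) powr b + (1 - q) * (1 + e) powr b) / b"
      by (simp add: add_divide_distrib diff_divide_distrib algebra_simps)
    also have "\<dots> = m * (1 / a + K / b)"
      by (simp add: K_def m_def[symmetric] distrib_left)
    also have "\<dots> \<le> m * (1 + b * \<eta>\<^sup>2)"
    proof (intro mult_left_mono[OF _ m])
      have "K / b \<le> (1 + b\<^sup>2 * \<eta>\<^sup>2) / b"
        using K b by (intro divide_right_mono) auto
      also have "\<dots> = 1 / b + b * \<eta>\<^sup>2"
        using b by (simp add: field_simps power2_eq_square)
      finally show "1 / a + K / b \<le> 1 + b * \<eta>\<^sup>2"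
        using a by linarith
    qed
    also have "\<dots> \<le> m * exp (b * \<eta>\<^sup>2)"
      by (intro mult_left_mono[OF _ m]) (rule exp_ge_add_one_self)
    also have "\<dots> = (m powr (1 / a) * exp (b * \<eta>\<^sup>2)) * ?t"
      using m a powr_add[of m "1 / a" "1 / b"] by simp
    finally have "s \<le> m powr (1 / a) * exp (b * \<eta>\<^sup>2)"
      using m False by simp
    moreover have "0 \<le> s"
      unfolding s_def using p u by (intro add_nonneg_nonneg mult_nonneg_nonneg) auto
    ultimately have "s powr a \<le> (m powr (1 / a) * exp (b * \<eta>\<^sup>2)) powr a"
      using a by (intro powr_mono2) auto
    also have "\<dots> = exp (b * \<eta>\<^sup>2) powr a * m"
      using m a by (simp add: powr_mult powr_powr)
    finally show ?thesis .
  qed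
  then show "measure_pmf.expectation (bernoulli_pmf p) u powr (b / (b - 1)) \<le>
      exp (b * \<eta>\<^sup>2) powr (b / (b - 1)) * measure_pmf.expectation (bernoulli_pmf q) (\<lambda>x. u x powr (b / (b - 1)))"
    using p q by (simp add: s_def m_def a_def mult.commute)
qed

lemma holder_close_binomial:
  assumes bern: "holder_close a D (bernoulli_pmf p) (bernoulli_pmf q)" and "1 < a" "0 \<le> D"
    and "p \<in> {0..1}" "q \<in> {0..1}"
  shows "holder_close a (D ^ N) (binomial_pmf N p) (binomial_pmf N q)"
proof (induction N)
  case 0
  then show ?case
    using assms by (simp add: binomial_pmf_0 holder_close_refl)
next
  case (Suc N)
  show ?case
    using assms Suc
    by (simp only: binomial_pmf_Suc power_Suc map_pmf_def[symmetric])
       (intro holder_close_bind holder_close_map bern; simp)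
qed

text \<open>The adversary draws from the same kernel on both sides and costs the factor 1; each
  answer costs the factor \<open>D\<close>, whatever the history.\<close>

lemma holder_close_stateless_play:
  assumes L: "\<And>q. q \<in> Q \<Longrightarrow> holder_close a D (L q) (L' q)" and A: "\<And>h. set_pmf (A h) \<subseteq> Q"
    and a: "1 < a" and D: "0 \<le> D"
  shows "holder_close a (D ^ j) (stateless_play L A j h) (stateless_play L' A j h)"
proof (induction j arbitrary: h)
  case 0
  then show ?case
    using a by (simp add: holder_close_refl)
next
  case (Suc j)
  have "holder_close a (1 * (D * D ^ j)) (stateless_play L A (Suc j) h) (stateless_play L' A (Suc j) h)"
    unfolding stateless_play.simps using a D A L Suc
    by (intro holder_close_bind holder_close_refl L subsetD[OF A]) auto
  then show ?case
    by simp
qed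

text \<open>Young's inequality trades the exponent \<open>a\<close> for the multiplicative and additive errors of
  approximate differential privacy.\<close>

lemma holder_close_imp_approximately_private:
  assumes H: "holder_close (b / (b - 1)) (exp c powr (b / (b - 1))) P Q" and b: "1 < b"
    and \<phi>: "\<And>x. 0 \<le> \<phi> x \<and> \<phi> x \<le> 1"
  shows "measure_pmf.expectation P \<phi> \<le>
    exp (c + t) * measure_pmf.expectation Q \<phi> + exp (c - (b - 1) * t)"
proof -
  define a where "a = b / (b - 1)"
  have a: "1 < a" "1 / a + 1 / b = 1" "b / a = b - 1"
    using b by (auto simp: a_def divide_simps)
  let ?x = "measure_pmf.expectation P \<phi>" and ?y = "measure_pmf.expectation Q \<phi>"
  have xy: "0 \<le> ?x" "0 \<le> ?y"
    using expectation_pmf_bounds[of \<phi> 1] \<phi> by auto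
  have "?x powr a \<le> exp c powr a * measure_pmf.expectation Q (\<lambda>x. \<phi> x powr a)"
    unfolding a_def by (rule holder_closeD[OF H \<phi>])
  also have "\<dots> \<le> exp c powr a * ?y"
  proof (intro mult_left_mono expectation_pmf_le[of _ 1 _ 1])
    show "\<phi> x powr a \<le> \<phi> x" for x
      using \<phi>[of x] a powr_mono'[of 1 a "\<phi> x"] by simp
    show "0 \<le> \<phi> x powr a \<and> \<phi> x powr a \<le> 1" for x
      by (rule powr_unit_interval) (use \<phi> a in auto)
  qed (use \<phi> in auto)
  finally have "(?x powr a) powr (1 / a) \<le> (exp c powr a * ?y) powr (1 / a)"
    using a by (intro powr_mono2) auto
  then have "?x \<le> exp c * ?y powr (1 / a)"
    using xy a by (simp add: powr_powr powr_mult)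
  also have "?y powr (1 / a) \<le> exp t * ?y + exp (- ((b - 1) * t))"
  proof -
    \<comment> \<open>The free parameter \<open>t\<close> is the multiplicative error; since
      \<open>b / a = b - 1\<close>, the second Young term becomes
      \<open>exp (- ((b - 1) * t)) / b\<close>.\<close>
    have "?y powr (1 / a) = (exp t * ?y) powr (1 / a) * exp (- (t / a))"
    proof -
      have "exp t powr (1 / a) = exp (t / a)"
        by (simp add: powr_def)
      then show ?thesis
        using xy by (simp add: powr_mult exp_minus)
    qed
    also have "\<dots> \<le> ((exp t * ?y) powr (1 / a)) powr a / a + exp (- (t / a)) powr b / b"
      using a b xy by (intro Youngs_inequality) auto
    also have "\<dots> = exp t * ?y / a + exp (- ((b - 1) * t)) / b"
    proof -
      have "exp (- (t / a)) powr b = exp (- (b / a * t))"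
        by (simp add: powr_def)
      then show ?thesis
        using xy a by (simp add: powr_powr)
    qed
    also have "\<dots> \<le> exp t * ?y + exp (- ((b - 1) * t))"
    proof -
      have "x / r \<le> x" if "0 \<le> x" "1 < r" for x r :: real
        using that mult_left_mono[of 1 r x] by (simp add: pos_divide_le_eq)
      then show ?thesis
        using xy a(1) b by (intro add_mono) simp_all
    qed
    finally show ?thesis .
  qed
  finally show ?thesis
    by (simp add: exp_add exp_diff exp_minus field_simps)
qed

section \<open>Resampling a coordinate of a Markov chain\<close>

lemma finite_tuples: "finite \<Omega> \<Longrightarrow> finite (tuples \<Omega> n)"
  unfolding tuples_def by (rule finite_lists_length_eq)

lemma list_update_tuples:
  "S \<in> tuples \<Omega> n \<Longrightarrow> y \<in> \<Omega> \<Longrightarrow> S[i := y] \<in> tuples \<Omega> n"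
  unfolding tuples_def using set_update_subset_insert[of S i y] by auto

lemma nth_tuples: "S \<in> tuples \<Omega> n \<Longrightarrow> i < n \<Longrightarrow> S ! i \<in> \<Omega>"
  unfolding tuples_def using nth_mem by blast

text \<open>Both weights are compared with the uniform one. Let \<open>F\<close> and
  \<open>G\<close> be the masses of \<open>f\<close> and \<open>1 - f\<close>. As weights stay
  within a factor \<rho>, the mean for \<open>w\<close> is at most
  \<open>\<rho> * F / (\<rho> * F + G)\<close> and the mean for \<open>v\<close> at least
  \<open>F / (F + \<rho> * G)\<close>. The gap between these two is largest for
  \<open>F = G\<close>, where it equals \<open>(\<rho> - 1) / (\<rho> + 1)\<close>.\<close>

lemma weighted_mean_diff_le:
  fixes f w v :: "'a \<Rightarrow> real"
  assumes \<Omega>: "finite \<Omega>" "\<Omega> \<noteq> {}" and f: "\<And>y. y \<in> \<Omega> \<Longrightarrow> 0 \<le> f y \<and> f y \<le> 1"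
    and w: "\<And>y. y \<in> \<Omega> \<Longrightarrow> 0 < w y" "\<And>y z. y \<in> \<Omega> \<Longrightarrow> z \<in> \<Omega> \<Longrightarrow> w y \<le> \<rho> * w z"
    and v: "\<And>y. y \<in> \<Omega> \<Longrightarrow> 0 < v y" "\<And>y z. y \<in> \<Omega> \<Longrightarrow> z \<in> \<Omega> \<Longrightarrow> v y \<le> \<rho> * v z"
  shows "(\<Sum>y\<in>\<Omega>. f y * w y) / sum w \<Omega> \<le> (\<Sum>y\<in>\<Omega>. f y * v y) / sum v \<Omega> + (\<rho> - 1) / (\<rho> + 1)"
proof -
  obtain z where z: "z \<in> \<Omega>" using \<Omega> by auto
  have "1 * w z \<le> \<rho> * w z" using w(2)[OF z z] by simp
  then have \<rho>: "1 \<le> \<rho>"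
    using w(1)[OF z] by (simp only: mult_le_cancel_right_pos)
  define F G where "F = sum f \<Omega>" and "G = (\<Sum>y\<in>\<Omega>. 1 - f y)"
  have F: "0 \<le> F" and G: "0 \<le> G"
    unfolding F_def G_def using f by (auto intro!: sum_nonneg)
  have "F + G = card \<Omega>"
    unfolding F_def G_def by (simp add: sum.distrib[symmetric])
  then have FG: "0 < F + G"
    using \<Omega> by (simp add: card_gt_0_iff)
  have pos: "0 < \<rho> * F + G" "0 < F + \<rho> * G"
    using mult_right_mono[of 1 \<rho> F] mult_right_mono[of 1 \<rho> G] FG F G \<rho> by simp_all
  have split: "sum u \<Omega> = (\<Sum>y\<in>\<Omega>. f y * u y) + (\<Sum>y\<in>\<Omega>. (1 - f y) * u y)" for u :: "'a \<Rightarrow> real"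
    by (simp add: sum.distrib[symmetric] algebra_simps)
  have cross: "x / y \<le> z / t" if "0 < y" "0 < t" "x * t \<le> z * y" for x y z t :: real
    using that by (simp add: divide_le_eq le_divide_eq mult.commute)
  let ?between = "\<lambda>u m. 0 < m \<and> (\<forall>h. (\<forall>y\<in>\<Omega>. 0 \<le> h y) \<longrightarrow>
      m * sum h \<Omega> \<le> (\<Sum>y\<in>\<Omega>. h y * u y) \<and> (\<Sum>y\<in>\<Omega>. h y * u y) \<le> \<rho> * m * sum h \<Omega>)"
  have extremes: "\<exists>m. ?between u m"
    if u: "\<And>y. y \<in> \<Omega> \<Longrightarrow> 0 < u y" "\<And>y z. y \<in> \<Omega> \<Longrightarrow> z \<in> \<Omega> \<Longrightarrow> u y \<le> \<rho> * u z" for u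
  proof -
    have "Min (u ` \<Omega>) \<in> u ` \<Omega>" using \<Omega> by simp
    then obtain z where z: "z \<in> \<Omega>" "Min (u ` \<Omega>) = u z" by auto
    have "u z \<le> u y" if "y \<in> \<Omega>" for y
      using \<Omega>(1) that by (simp add: z(2)[symmetric])
    then have "u z * sum h \<Omega> \<le> (\<Sum>y\<in>\<Omega>. h y * u y) \<and> (\<Sum>y\<in>\<Omega>. h y * u y) \<le> \<rho> * u z * sum h \<Omega>"
      if h: "\<forall>y\<in>\<Omega>. 0 \<le> h y" for h
      unfolding sum_distrib_left mult.commute[of "u _"] mult.commute[of "\<rho> * u _"]
      using h u(2)[OF _ z(1)] by (intro conjI sum_mono mult_left_mono) simp_all
    then show ?thesis
      using u(1)[OF z(1)] by blast
  qed
  have "\<exists>m. ?between w m" "\<exists>m. ?between v m"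
    by (rule extremes; rule w v; assumption)+
  then obtain m m' where m: "?between w m" and m': "?between v m'"
    by (elim exE) (rule that)
  define A B where "A = (\<Sum>y\<in>\<Omega>. f y * w y)" and "B = (\<Sum>y\<in>\<Omega>. (1 - f y) * w y)"
  define A' B' where "A' = (\<Sum>y\<in>\<Omega>. f y * v y)" and "B' = (\<Sum>y\<in>\<Omega>. (1 - f y) * v y)"
  have AB: "A \<le> \<rho> * m * F" "m * G \<le> B" "m' * F \<le> A'" "B' \<le> \<rho> * m' * G"
    using m[THEN conjunct2, rule_format, of f] m[THEN conjunct2, rule_format, of "\<lambda>y. 1 - f y"]
      m'[THEN conjunct2, rule_format, of f] m'[THEN conjunct2, rule_format, of "\<lambda>y. 1 - f y"] f
    unfolding A_def B_def A'_def B'_def F_def G_def by auto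
  have "0 < sum w \<Omega>" "0 < sum v \<Omega>"
    using \<Omega> w(1) v(1) by (auto intro: sum_pos)
  then have sums: "sum w \<Omega> = A + B" "sum v \<Omega> = A' + B'" "0 < A + B" "0 < A' + B'"
    using split[of w] split[of v] unfolding A_def B_def A'_def B'_def by auto
  have "A * G \<le> \<rho> * m * F * G"
    by (rule mult_right_mono[OF AB(1) G])
  also have "\<dots> = \<rho> * F * (m * G)"
    by simp
  also have "\<dots> \<le> \<rho> * F * B"
    using AB(2) \<rho> F by (intro mult_left_mono) auto
  finally have "A / (A + B) \<le> \<rho> * F / (\<rho> * F + G)"
    by (intro cross sums pos) (simp add: distrib_left mult.commute mult.left_commute)
  also have "\<dots> \<le> F / (F + \<rho> * G) + (\<rho> - 1) / (\<rho> + 1)"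
  proof -
    have "\<rho> * F / (\<rho> * F + G) - F / (F + \<rho> * G) =
        F * G * (\<rho>\<^sup>2 - 1) / ((\<rho> * F + G) * (F + \<rho> * G))"
    proof -
      have "\<rho> * F / (\<rho> * F + G) - F / (F + \<rho> * G) =
          (\<rho> * F * (F + \<rho> * G) - F * (\<rho> * F + G)) / ((\<rho> * F + G) * (F + \<rho> * G))"
        using pos by (intro diff_frac_eq) auto
      also have "\<rho> * F * (F + \<rho> * G) - F * (\<rho> * F + G) = F * G * (\<rho>\<^sup>2 - 1)"
        by (simp add: algebra_simps power2_eq_square)
      finally show ?thesis .
    qed
    also have "\<dots> \<le> (\<rho> - 1) / (\<rho> + 1)"
    proof -
      \<comment> \<open>The slack is a multiple of a square that vanishes in the balanced case
        \<open>F = G\<close>.\<close>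
      have "(\<rho> - 1) * ((\<rho> * F + G) * (F + \<rho> * G)) - F * G * (\<rho>\<^sup>2 - 1) * (\<rho> + 1) = (\<rho> - 1) * \<rho> * (F - G)\<^sup>2"
        by (simp add: algebra_simps power2_eq_square)
      moreover have "0 \<le> (\<rho> - 1) * \<rho> * (F - G)\<^sup>2"
        using \<rho> by simp
      ultimately have "F * G * (\<rho>\<^sup>2 - 1) * (\<rho> + 1) \<le> (\<rho> - 1) * ((\<rho> * F + G) * (F + \<rho> * G))"
        by linarith
      then show ?thesis
        using \<rho> by (intro cross mult_pos_pos pos) simp_all
    qed
    finally show ?thesis by simp
  qed
  also have "F / (F + \<rho> * G) \<le> A' / (A' + B')"
  proof -
    have "F * B' \<le> F * (\<rho> * m' * G)"
      by (rule mult_left_mono[OF AB(4) F])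
    also have "\<dots> = \<rho> * G * (m' * F)"
      by simp
    also have "\<dots> \<le> \<rho> * G * A'"
      using AB(3) \<rho> G by (intro mult_left_mono) auto
    finally show ?thesis
      by (intro cross sums pos) (simp add: distrib_left mult.commute mult.left_commute)
  qed
  finally show ?thesis
    unfolding sums A_def A'_def by simp
qed

text \<open>The conditional law of coordinate \<open>i\<close> given all others, that is, the
  heat-bath kernel of Gibbs sampling; it ignores \<open>S ! i\<close>.\<close>

definition resample_weight :: "'a set \<Rightarrow> 'a list pmf \<Rightarrow> nat \<Rightarrow> 'a list \<Rightarrow> 'a \<Rightarrow> real" where
  "resample_weight \<Omega> \<mu> i S y = pmf \<mu> (S[i := y]) / (\<Sum>z\<in>\<Omega>. pmf \<mu> (S[i := z]))"

text \<open>Exchanging a coordinate with its resampled value is an involution that preserves the joint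
  law.\<close>

lemma resample_swap:
  assumes "finite \<Omega>" and i: "i < n"
  shows "(\<Sum>S\<in>tuples \<Omega> n. \<Sum>y\<in>\<Omega>. pmf \<mu> S * resample_weight \<Omega> \<mu> i S y * F S y) =
    (\<Sum>S\<in>tuples \<Omega> n. \<Sum>y\<in>\<Omega>. pmf \<mu> S * resample_weight \<Omega> \<mu> i S y * F (S[i := y]) (S ! i))"
  unfolding sum.cartesian_product
proof (rule sum.reindex_bij_witness[where i = "\<lambda>(S, y). (S[i := y], S ! i)" and j = "\<lambda>(S, y). (S[i := y], S ! i)"],
    goal_cases)
  \<comment> \<open>Detailed balance: the weight is
    \<open>pmf \<mu> S * pmf \<mu> (S[i := y])\<close> over a normaliser that ignores coordinate
    \<open>i\<close>, hence symmetric under the exchange.\<close>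
  case (5 a)
  then show ?case
    using i by (auto simp: resample_weight_def tuples_def)
qed (use i in \<open>auto simp: list_update_tuples nth_tuples, auto simp: tuples_def\<close>)

lemma expectation_tuples:
  fixes f :: "'a list \<Rightarrow> real"
  assumes "finite \<Omega>" "set_pmf \<mu> \<subseteq> tuples \<Omega> n"
  shows "measure_pmf.expectation \<mu> f = (\<Sum>S\<in>tuples \<Omega> n. pmf \<mu> S * f S)"
  using assms by (subst integral_measure_pmf_real[of "tuples \<Omega> n"]) (auto simp: finite_tuples mult.commute)

section \<open>Conditional laws of the chain against marginal laws\<close>

context
  fixes \<Omega> :: "'a set" and n :: nat and g :: "nat \<Rightarrow> 'a \<Rightarrow> 'a \<Rightarrow> real" and \<mu> :: "'a list pmf"
  assumes chain: "undirected_markov_chain \<Omega> n g \<mu>"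
begin

lemma chain_simps:
  shows "finite \<Omega>" "\<Omega> \<noteq> {}" "2 \<le> n" "set_pmf \<mu> \<subseteq> tuples \<Omega> n"
    and "\<And>i a b. i < n - 1 \<Longrightarrow> a \<in> \<Omega> \<Longrightarrow> b \<in> \<Omega> \<Longrightarrow> 0 < g i a b"
    and "\<And>x. x \<in> tuples \<Omega> n \<Longrightarrow>
      pmf \<mu> x = chain_weight n g x / (\<Sum>x'\<in>tuples \<Omega> n. chain_weight n g x')"
  using chain unfolding undirected_markov_chain_def by blast+

lemma potential_bounds:
  shows "0 < r_min \<Omega> n g" "r_min \<Omega> n g \<le> R_max \<Omega> n g"
    and "\<And>i a b. i < n - 1 \<Longrightarrow> a \<in> \<Omega> \<Longrightarrow> b \<in> \<Omega> \<Longrightarrow> r_min \<Omega> n g \<le> g i a b \<and> g i a b \<le> R_max \<Omega> n g"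
proof -
  let ?V = "potential_values \<Omega> n g"
  have V: "?V = (\<lambda>(i, a, b). g i a b) ` ({..<n-1} \<times> \<Omega> \<times> \<Omega>)"
    unfolding potential_values_def by force
  have fin: "finite ?V" and ne: "?V \<noteq> {}"
    unfolding V using chain_simps(1-3) by (auto simp: lessThan_empty_iff)
  show *: "r_min \<Omega> n g \<le> g i a b \<and> g i a b \<le> R_max \<Omega> n g" if "i < n - 1" "a \<in> \<Omega>" "b \<in> \<Omega>" for i a b
    unfolding r_min_def R_max_def using that fin
    by (intro conjI Min_le Max_ge) (auto simp: potential_values_def)
  have "Min ?V \<in> ?V"
    by (rule Min_in[OF fin ne])
  then show "0 < r_min \<Omega> n g" "r_min \<Omega> n g \<le> R_max \<Omega> n g"
    using chain_simps(5) Max_ge[OF fin] unfolding r_min_def R_max_def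
    by (auto simp: potential_values_def)
qed

lemma R_bar_bounds: "0 \<le> R_bar \<Omega> n g" "R_bar \<Omega> n g \<le> 1"
proof -
  have "(r_min \<Omega> n g)\<^sup>2 \<le> (R_max \<Omega> n g)\<^sup>2"
    using potential_bounds(1,2) by (intro power_mono) auto
  then show "0 \<le> R_bar \<Omega> n g"
    unfolding R_bar_def by simp
  have "0 < (R_max \<Omega> n g)\<^sup>2 + (r_min \<Omega> n g)\<^sup>2"
    using potential_bounds(1) by (simp add: add_nonneg_pos)
  then show "R_bar \<Omega> n g \<le> 1"
    unfolding R_bar_def by (simp add: divide_le_eq)
qed

lemma chain_weight_pos:
  assumes "S \<in> tuples \<Omega> n"
  shows "0 < chain_weight n g S"
  unfolding chain_weight_def using assms chain_simps(5) by (auto intro!: prod_pos simp: nth_tuples)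

text \<open>Only the two potentials adjacent to coordinate \<open>i\<close> change.\<close>

lemma chain_weight_update_le:
  assumes S: "S \<in> tuples \<Omega> n" and yz: "y \<in> \<Omega>" "z \<in> \<Omega>" and i: "i < n"
  shows "chain_weight n g (S[i := y]) \<le>
    (R_max \<Omega> n g / r_min \<Omega> n g)\<^sup>2 * chain_weight n g (S[i := z])"
proof -
  let ?q = "R_max \<Omega> n g / r_min \<Omega> n g"
  let ?I = "{j. j < n - 1 \<and> (j = i \<or> Suc j = i)}"
  have q: "1 \<le> ?q"
    using potential_bounds(1,2) by simp
  have upd: "S[i := x] ! j \<in> \<Omega>" if "x \<in> \<Omega>" "j < n" for x j
    using that S by (intro nth_tuples[OF list_update_tuples])
  have "chain_weight n g (S[i := y]) \<le>
      (\<Prod>j<n-1. (if j = i \<or> Suc j = i then ?q else 1) * g j (S[i := z] ! j) (S[i := z] ! (j + 1)))"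
    unfolding chain_weight_def
  proof (rule prod_mono)
    fix j assume "j \<in> {..<n-1}"
    then have j: "j < n - 1" "j < n" "Suc j < n" by auto
    have pos: "0 < g j (S[i := y] ! j) (S[i := y] ! (j + 1))"
      using j yz by (intro chain_simps(5) upd) auto
    have "g j (S[i := y] ! j) (S[i := y] ! (j + 1)) \<le> ?q * g j (S[i := z] ! j) (S[i := z] ! (j + 1))"
    proof -
      have "g j (S[i := y] ! j) (S[i := y] ! (j + 1)) \<le> ?q * r_min \<Omega> n g"
        using potential_bounds(3)[of j] potential_bounds(1) upd j yz by simp
      also have "\<dots> \<le> ?q * g j (S[i := z] ! j) (S[i := z] ! (j + 1))"
        using potential_bounds(3)[of j] upd j yz q by (intro mult_left_mono) auto
      finally show ?thesis .
    qed
    then show "0 \<le> g j (S[i := y] ! j) (S[i := y] ! (j + 1)) \<and>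
        g j (S[i := y] ! j) (S[i := y] ! (j + 1)) \<le>
        (if j = i \<or> Suc j = i then ?q else 1) * g j (S[i := z] ! j) (S[i := z] ! (j + 1))"
      using pos by auto
  qed
  also have "\<dots> = (\<Prod>j<n-1. if j = i \<or> Suc j = i then ?q else 1) * chain_weight n g (S[i := z])"
    by (simp add: prod.distrib chain_weight_def)
  also have "(\<Prod>j<n-1. if j = i \<or> Suc j = i then ?q else 1) = ?q ^ card ?I"
  proof -
    have "{..<n-1} \<inter> {j. j = i \<or> Suc j = i} = ?I" by auto
    then show ?thesis by (simp add: prod.If_cases)
  qed
  also have "?q ^ card ?I * chain_weight n g (S[i := z]) \<le> ?q\<^sup>2 * chain_weight n g (S[i := z])"
  proof (intro mult_right_mono power_increasing q)
    \<comment> \<open>For \<open>i = 0\<close> the truncated \<open>i - 1\<close> merely repeats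
      \<open>i\<close>; the end coordinates have only one adjacent potential.\<close>
    have "card ?I \<le> card {i, i - 1}"
      by (rule card_mono) auto
    also have "\<dots> \<le> 2"
      by (simp add: card_insert_if)
    finally show "card ?I \<le> 2" .
    show "0 \<le> chain_weight n g (S[i := z])"
      by (rule less_imp_le[OF chain_weight_pos[OF list_update_tuples[OF S yz(2)]]])
  qed
  finally show ?thesis .
qed

lemma chain_pmf_pos:
  assumes "S \<in> tuples \<Omega> n"
  shows "0 < pmf \<mu> S"
  unfolding chain_simps(6)[OF assms] using assms chain_weight_pos finite_tuples[OF chain_simps(1)]
  by (intro divide_pos_pos sum_pos) auto

lemma chain_pmf_update_le:
  assumes "S \<in> tuples \<Omega> n" "y \<in> \<Omega>" "z \<in> \<Omega>" "i < n"
  shows "pmf \<mu> (S[i := y]) \<le> (R_max \<Omega> n g / r_min \<Omega> n g)\<^sup>2 * pmf \<mu> (S[i := z])"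
proof -
  have "0 \<le> (\<Sum>x'\<in>tuples \<Omega> n. chain_weight n g x')"
    by (intro sum_nonneg) (use chain_weight_pos in \<open>auto intro: less_imp_le\<close>)
  then show ?thesis
    using divide_right_mono[OF chain_weight_update_le[OF assms]] assms
    by (simp add: chain_simps(6) list_update_tuples)
qed

lemma sum_resample_weight:
  assumes "S \<in> tuples \<Omega> n"
  shows "(\<Sum>y\<in>\<Omega>. resample_weight \<Omega> \<mu> i S y) = 1"
proof -
  have "0 < (\<Sum>z\<in>\<Omega>. pmf \<mu> (S[i := z]))"
    using chain_pmf_pos[OF list_update_tuples[OF assms]] chain_simps(1,2) by (intro sum_pos) auto
  then show ?thesis
    unfolding resample_weight_def by (simp add: sum_divide_distrib[symmetric])
qed

lemma resample_weight_nonneg: "0 \<le> resample_weight \<Omega> \<mu> i S y"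
  unfolding resample_weight_def by (simp add: sum_nonneg)

text \<open>Exchangeability in the form used below: on the right, \<open>y\<close> is an entry of
  the dataset on which the process runs. Stability will replace \<open>S[i := y]\<close> by
  \<open>S\<close>, after which \<open>y\<close> is, given \<open>S\<close>, independent of what the
  process outputs.\<close>

lemma expectation_resample:
  fixes F :: "'a list \<Rightarrow> 'a \<Rightarrow> real"
  assumes i: "i < n"
  shows "measure_pmf.expectation \<mu> (\<lambda>S. F S (S ! i)) =
    measure_pmf.expectation \<mu> (\<lambda>S. \<Sum>y\<in>\<Omega>. resample_weight \<Omega> \<mu> i S y * F (S[i := y]) y)"
proof -
  have "measure_pmf.expectation \<mu> (\<lambda>S. F S (S ! i)) =
     (\<Sum>S\<in>tuples \<Omega> n. \<Sum>y\<in>\<Omega>. pmf \<mu> S * resample_weight \<Omega> \<mu> i S y * F S (S ! i))"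
    unfolding expectation_tuples[OF chain_simps(1,4)]
    by (intro sum.cong refl)
       (simp add: sum_distrib_left[symmetric] sum_distrib_right[symmetric] sum_resample_weight)
  also have "\<dots> = (\<Sum>S\<in>tuples \<Omega> n. \<Sum>y\<in>\<Omega>. pmf \<mu> S * resample_weight \<Omega> \<mu> i S y *
      F (S[i := y]) (S[i := y] ! i))"
    by (rule resample_swap[OF chain_simps(1) i, where F = "\<lambda>S y. F S (S ! i)"])
  also have "\<dots> = measure_pmf.expectation \<mu> (\<lambda>S. \<Sum>y\<in>\<Omega>. resample_weight \<Omega> \<mu> i S y * F (S[i := y]) y)"
    unfolding expectation_tuples[OF chain_simps(1,4)] using i
    by (intro sum.cong refl) (auto simp: sum_distrib_left mult.assoc tuples_def)
  finally show ?thesis .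
qed

text \<open>\<open>weighted_mean_diff_le\<close> with \<open>\<rho> = (R_max / r_min)^2\<close>
  compares the conditional mean at \<open>S\<close> with that at any \<open>S'\<close>, and
  \<open>(\<rho> - 1) / (\<rho> + 1)\<close> is \<open>R_bar\<close>. Averaging over
  \<open>S'\<close> turns the second conditional mean into the marginal one.\<close>

lemma resample_mean_le:
  fixes f :: "'a \<Rightarrow> real"
  assumes f: "\<And>y. 0 \<le> f y \<and> f y \<le> 1" and i: "i < n" and S: "S \<in> tuples \<Omega> n"
  shows "(\<Sum>y\<in>\<Omega>. resample_weight \<Omega> \<mu> i S y * f y) \<le>
    measure_pmf.expectation \<mu> (\<lambda>S'. f (S' ! i)) + R_bar \<Omega> n g"
proof -
  let ?\<rho> = "(R_max \<Omega> n g / r_min \<Omega> n g)\<^sup>2"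
  let ?m = "\<lambda>S. \<Sum>y\<in>\<Omega>. resample_weight \<Omega> \<mu> i S y * f y"
  have m: "?m S' = (\<Sum>y\<in>\<Omega>. f y * pmf \<mu> (S'[i := y])) / (\<Sum>y\<in>\<Omega>. pmf \<mu> (S'[i := y]))" for S'
    by (simp add: resample_weight_def sum_divide_distrib mult.commute)
  have \<rho>: "(?\<rho> - 1) / (?\<rho> + 1) = R_bar \<Omega> n g"
  proof -
    have "x / y - 1 = (x - y) / y" "x / y + 1 = (x + y) / y" if "0 < y" for x y :: real
      using that by (simp_all add: field_simps)
    then show ?thesis
      using potential_bounds(1) by (simp add: R_bar_def power_divide)
  qed
  have le: "?m S \<le> ?m S' + R_bar \<Omega> n g" if "S' \<in> tuples \<Omega> n" for S'
    unfolding m \<rho>[symmetric] using S that i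
    by (intro weighted_mean_diff_le chain_simps(1,2) f chain_pmf_pos chain_pmf_update_le list_update_tuples)
  have const: "(\<Sum>S'\<in>tuples \<Omega> n. pmf \<mu> S' * r) = r" for r
    using expectation_tuples[OF chain_simps(1,4), of "\<lambda>_. r"] by simp
  have "?m S = (\<Sum>S'\<in>tuples \<Omega> n. pmf \<mu> S' * ?m S)"
    by (simp add: const)
  also have "\<dots> \<le> (\<Sum>S'\<in>tuples \<Omega> n. pmf \<mu> S' * (?m S' + R_bar \<Omega> n g))"
    using le by (intro sum_mono mult_left_mono) auto
  also have "\<dots> = measure_pmf.expectation \<mu> ?m + R_bar \<Omega> n g"
    by (simp add: expectation_tuples[OF chain_simps(1,4)] distrib_left sum.distrib const)
  also have "measure_pmf.expectation \<mu> ?m = measure_pmf.expectation \<mu> (\<lambda>S'. f (S' ! i))"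
    by (rule expectation_resample[OF i, where F = "\<lambda>_. f", symmetric])
  finally show ?thesis .
qed

lemma query_on_tuples:
  "S \<in> tuples \<Omega> n \<Longrightarrow> query_on q S = (\<Sum>i<n. q (S ! i)) / real n"
  by (simp add: query_on_def tuples_def sum_list_sum_nth atLeast0LessThan)

lemma query_mean_eq: "query_mean q \<mu> = (\<Sum>i<n. measure_pmf.expectation \<mu> (\<lambda>S. q (S ! i))) / real n"
  unfolding query_mean_def expectation_tuples[OF chain_simps(1,4)]
  by (subst sum.swap) (simp add: query_on_tuples sum_divide_distrib sum_distrib_left)

text \<open>For each coordinate: exchange, apply stability to the test function
  \<open>indicator B h * f h y\<close> with \<open>y\<close> fixed, then average over
  \<open>y\<close> given \<open>S\<close>. The mean over the coordinates restores the query. The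
  event \<open>B\<close> is carried along as part of the test function.\<close>

lemma decoupling:
  fixes G :: "'a list \<Rightarrow> 'h pmf" and f :: "'h \<Rightarrow> 'a \<Rightarrow> real"
  assumes stable: "\<And>S i y \<phi>. S \<in> tuples \<Omega> n \<Longrightarrow> i < n \<Longrightarrow> y \<in> \<Omega> \<Longrightarrow> (\<And>h. 0 \<le> \<phi> h \<and> \<phi> h \<le> 1) \<Longrightarrow>
      measure_pmf.expectation (G (S[i := y])) \<phi> \<le> c * measure_pmf.expectation (G S) \<phi> + \<delta>"
    and c: "0 \<le> c" and f: "\<And>h x. 0 \<le> f h x \<and> f h x \<le> 1"
  shows "measure_pmf.expectation \<mu> (\<lambda>S. measure_pmf.expectation (G S)
      (\<lambda>h. indicator B h * query_on (f h) S)) \<le>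
    c * measure_pmf.expectation \<mu> (\<lambda>S. measure_pmf.expectation (G S)
      (\<lambda>h. indicator B h * (query_mean (f h) \<mu> + R_bar \<Omega> n g))) + \<delta>"
proof -
  let ?E = "\<lambda>S. measure_pmf.expectation (G S)"
  let ?\<Phi> = "\<lambda>S y. ?E S (\<lambda>h. indicator B h * f h y)"
  let ?M = "\<lambda>i h. measure_pmf.expectation \<mu> (\<lambda>S. f h (S ! i))"
  have Bf: "0 \<le> (indicator B h :: real) * f h y \<and> indicator B h * f h y \<le> 1" for h y
    using f by (simp add: indicator_def)
  have M: "0 \<le> ?M i h" "?M i h \<le> 1" for i h
    using f by (auto intro!: expectation_pmf_bounds)
  have n: "0 < n"
    using chain_simps(3) by simp
  have step: "measure_pmf.expectation \<mu> (\<lambda>S. ?\<Phi> S (S ! i)) \<le>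
      c * measure_pmf.expectation \<mu> (\<lambda>S. ?E S (\<lambda>h. indicator B h * (?M i h + R_bar \<Omega> n g))) + \<delta>"
    if i: "i < n" for i
  proof -
    have "(\<Sum>y\<in>\<Omega>. resample_weight \<Omega> \<mu> i S y * ?\<Phi> (S[i := y]) y) \<le>
        c * ?E S (\<lambda>h. indicator B h * (?M i h + R_bar \<Omega> n g)) + \<delta>" if S: "S \<in> tuples \<Omega> n" for S
    proof -
      have "(\<Sum>y\<in>\<Omega>. resample_weight \<Omega> \<mu> i S y * ?\<Phi> (S[i := y]) y) \<le>
          (\<Sum>y\<in>\<Omega>. resample_weight \<Omega> \<mu> i S y * (c * ?\<Phi> S y + \<delta>))"
        using stable[OF S i _ Bf] resample_weight_nonneg by (intro sum_mono mult_left_mono) auto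
      also have "\<dots> = c * (\<Sum>y\<in>\<Omega>. resample_weight \<Omega> \<mu> i S y * ?\<Phi> S y) + (\<Sum>y\<in>\<Omega>. resample_weight \<Omega> \<mu> i S y) * \<delta>"
        by (simp add: distrib_left sum.distrib sum_distrib_left sum_distrib_right mult.left_commute)
      also have "(\<Sum>y\<in>\<Omega>. resample_weight \<Omega> \<mu> i S y * ?\<Phi> S y) =
          ?E S (\<lambda>h. \<Sum>y\<in>\<Omega>. resample_weight \<Omega> \<mu> i S y * (indicator B h * f h y))"
        by (subst Bochner_Integration.integral_sum)
           (auto intro!: integrable_mult_right integrable_pmf_bounded[where B = 1] simp: Bf)
      also have "\<dots> \<le> ?E S (\<lambda>h. indicator B h * (?M i h + R_bar \<Omega> n g))"
      proof (rule expectation_pmf_le[of _ 1 _ 2])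
        fix h
        have *: "(\<Sum>y\<in>\<Omega>. resample_weight \<Omega> \<mu> i S y * (indicator B h * f h y)) =
            indicator B h * (\<Sum>y\<in>\<Omega>. resample_weight \<Omega> \<mu> i S y * f h y)"
          by (simp add: sum_distrib_left mult.left_commute)
        show "(\<Sum>y\<in>\<Omega>. resample_weight \<Omega> \<mu> i S y * (indicator B h * f h y)) \<le>
            indicator B h * (?M i h + R_bar \<Omega> n g)"
          unfolding * by (intro mult_left_mono resample_mean_le f i S) auto
        have "(\<Sum>y\<in>\<Omega>. resample_weight \<Omega> \<mu> i S y * (indicator B h * f h y)) \<le>
            (\<Sum>y\<in>\<Omega>. resample_weight \<Omega> \<mu> i S y * 1)"
          using Bf resample_weight_nonneg by (intro sum_mono mult_left_mono) auto
        then show "0 \<le> (\<Sum>y\<in>\<Omega>. resample_weight \<Omega> \<mu> i S y * (indicator B h * f h y)) \<and>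
            (\<Sum>y\<in>\<Omega>. resample_weight \<Omega> \<mu> i S y * (indicator B h * f h y)) \<le> 1"
          using f resample_weight_nonneg sum_resample_weight[OF S]
          by (auto intro!: sum_nonneg mult_nonneg_nonneg)
        show "0 \<le> indicator B h * (?M i h + R_bar \<Omega> n g) \<and> indicator B h * (?M i h + R_bar \<Omega> n g) \<le> 2"
          using M[of h i] R_bar_bounds by (simp add: indicator_def)
      qed
      finally show ?thesis
        using c sum_resample_weight[OF S] by (simp add: mult_left_mono)
    qed
    then have "(\<Sum>S\<in>tuples \<Omega> n. pmf \<mu> S * (\<Sum>y\<in>\<Omega>. resample_weight \<Omega> \<mu> i S y * ?\<Phi> (S[i := y]) y)) \<le>
        (\<Sum>S\<in>tuples \<Omega> n. pmf \<mu> S * (c * ?E S (\<lambda>h. indicator B h * (?M i h + R_bar \<Omega> n g)) + \<delta>))"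
      by (intro sum_mono mult_left_mono) auto
    also have "\<dots> = c * (\<Sum>S\<in>tuples \<Omega> n. pmf \<mu> S * ?E S (\<lambda>h. indicator B h * (?M i h + R_bar \<Omega> n g))) + \<delta>"
      using expectation_tuples[OF chain_simps(1,4), of "\<lambda>_. \<delta>", symmetric]
      by (simp add: distrib_left sum.distrib sum_distrib_left mult.left_commute)
    finally show ?thesis
      unfolding expectation_resample[OF i, where F = ?\<Phi>] expectation_tuples[OF chain_simps(1,4)] .
  qed
  have "measure_pmf.expectation \<mu> (\<lambda>S. ?E S (\<lambda>h. indicator B h * query_on (f h) S)) =
      (\<Sum>i<n. measure_pmf.expectation \<mu> (\<lambda>S. ?\<Phi> S (S ! i))) / real n"
  proof -
    have "?E S (\<lambda>h. indicator B h * query_on (f h) S) = (\<Sum>i<n. ?\<Phi> S (S ! i)) / real n"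
      if "S \<in> tuples \<Omega> n" for S
    proof -
      have "?E S (\<lambda>h. indicator B h * query_on (f h) S) =
          ?E S (\<lambda>h. (\<Sum>i<n. indicator B h * f h (S ! i)) / real n)"
        by (simp add: query_on_tuples[OF that] sum_distrib_left)
      also have "\<dots> = (\<Sum>i<n. ?\<Phi> S (S ! i)) / real n"
        unfolding integral_divide_zero
        by (subst Bochner_Integration.integral_sum) (auto intro: integrable_pmf_bounded[where B = 1] simp: Bf)
      finally show ?thesis .
    qed
    then show ?thesis
      unfolding expectation_tuples[OF chain_simps(1,4)]
      by (subst sum.swap) (simp add: sum_divide_distrib sum_distrib_left)
  qed
  also have "\<dots> \<le> (\<Sum>i<n. c * measure_pmf.expectation \<mu> (\<lambda>S. ?E S (\<lambda>h. indicator B h * (?M i h + R_bar \<Omega> n g))) + \<delta>) / real n"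
    by (intro divide_right_mono sum_mono step) auto
  also have "\<dots> = c * ((\<Sum>i<n. measure_pmf.expectation \<mu> (\<lambda>S. ?E S (\<lambda>h. indicator B h * (?M i h + R_bar \<Omega> n g)))) / real n) + \<delta>"
    using n by (simp add: sum.distrib sum_distrib_left add_divide_distrib)
  also have "(\<Sum>i<n. measure_pmf.expectation \<mu> (\<lambda>S. ?E S (\<lambda>h. indicator B h * (?M i h + R_bar \<Omega> n g)))) / real n =
      measure_pmf.expectation \<mu> (\<lambda>S. ?E S (\<lambda>h. indicator B h * (query_mean (f h) \<mu> + R_bar \<Omega> n g)))"
  proof -
    have "?E S (\<lambda>h. indicator B h * (query_mean (f h) \<mu> + R_bar \<Omega> n g)) =
        (\<Sum>i<n. ?E S (\<lambda>h. indicator B h * (?M i h + R_bar \<Omega> n g))) / real n" for S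
    proof -
      have "indicator B h * (query_mean (f h) \<mu> + R_bar \<Omega> n g) =
          (\<Sum>i<n. indicator B h * (?M i h + R_bar \<Omega> n g)) / real n" for h
        using n by (simp add: query_mean_eq sum.distrib sum_distrib_left[symmetric] field_simps)
      moreover have "0 \<le> indicator B h * (?M i h + R_bar \<Omega> n g) \<and> indicator B h * (?M i h + R_bar \<Omega> n g) \<le> 2" for i h
        using M[of h i] R_bar_bounds by (simp add: indicator_def)
      ultimately show ?thesis
        by (simp only: integral_divide_zero)
           (subst Bochner_Integration.integral_sum, auto intro: integrable_pmf_bounded[where B = 2])
    qed
    then show ?thesis
      unfolding expectation_tuples[OF chain_simps(1,4)]
      by (subst sum.swap) (simp add: sum_divide_distrib sum_distrib_left)
  qed
  finally show ?thesis .
qed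

end

section \<open>Statistical accuracy\<close>

lemma query_on_bounds:
  assumes "\<And>x. x \<in> set S \<Longrightarrow> 0 \<le> q x \<and> q x \<le> 1"
  shows "0 \<le> query_on q S \<and> query_on q S \<le> 1"
proof -
  have "0 \<le> (\<Sum>x\<leftarrow>S. q x)"
    using assms by (intro sum_list_nonneg) auto
  moreover have "(\<Sum>x\<leftarrow>S. q x) \<le> (\<Sum>x\<leftarrow>S. 1)"
    using assms by (intro sum_list_mono) auto
  ultimately show ?thesis
    by (auto simp: query_on_def sum_list_triv divide_le_eq_1)
qed

lemma query_on_complement:
  assumes "S \<noteq> []"
  shows "query_on (\<lambda>x. 1 - q x) S = 1 - query_on q S"
  using assms by (simp add: query_on_def sum_list_subtractf sum_list_triv diff_divide_distrib)

lemma query_on_update_diff: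
  assumes S: "S \<in> tuples \<Omega> n" and y: "y \<in> \<Omega>" and i: "i < n"
    and q: "\<And>x. x \<in> \<Omega> \<Longrightarrow> 0 \<le> q x \<and> q x \<le> 1"
  shows "\<bar>query_on q (S[i := y]) - query_on q S\<bar> \<le> 1 / real n"
proof -
  have len: "length S = n"
    using S by (simp add: tuples_def)
  have "query_on q (S[i := y]) - query_on q S = (q y - q (S ! i)) / real n"
  proof -
    have "(\<Sum>j<n. q (S[i := y] ! j)) - (\<Sum>j<n. q (S ! j)) = (\<Sum>j<n. if j = i then q y - q (S ! i) else 0)"
      unfolding sum_subtractf[symmetric] using len by (intro sum.cong) auto
    also have "\<dots> = q y - q (S ! i)"
      using i by simp
    finally show ?thesis
      using len by (simp add: query_on_def sum_list_sum_nth atLeast0LessThan diff_divide_distrib[symmetric])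
  qed
  moreover have "\<bar>q y - q (S ! i)\<bar> \<le> 1"
    using q[OF y] q[OF nth_tuples[OF S i]] by linarith
  ultimately show ?thesis
    by (simp add: divide_right_mono)
qed

lemma stateless_play_support:
  assumes "h' \<in> set_pmf (stateless_play L A j h)"
  shows "length h' = length h + j"
    and "(q, a) \<in> set h' \<Longrightarrow> (q, a) \<in> set h \<or> (\<exists>h. q \<in> set_pmf (A h)) \<and> a \<in> set_pmf (L q)"
proof -
  have "length h' = length h + j \<and> (\<forall>(q, a)\<in>set h'. (q, a) \<in> set h \<or> (\<exists>h. q \<in> set_pmf (A h)) \<and> a \<in> set_pmf (L q))"
    using assms
  proof (induction j arbitrary: h)
    case (Suc j)
    then obtain q a where qa: "q \<in> set_pmf (A h)" "a \<in> set_pmf (L q)"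
      and h': "h' \<in> set_pmf (stateless_play L A j (h @ [(q, a)]))"
      by auto
    show ?case
      using Suc.IH[OF h'] qa by fastforce
  qed auto
  then show "length h' = length h + j"
    and "(q, a) \<in> set h' \<Longrightarrow> (q, a) \<in> set h \<or> (\<exists>h. q \<in> set_pmf (A h)) \<and> a \<in> set_pmf (L q)"
    by auto
qed

text \<open>A union bound along the interaction: \<epsilon> bounds the failure of every possible
  query, hence also conditionally on the history, so adaptivity costs nothing.\<close>

lemma stateless_play_union_bound:
  assumes L: "\<And>h q. q \<in> set_pmf (A h) \<Longrightarrow> measure_pmf.prob (L q) {a. bad q a} \<le> \<epsilon>" and "0 \<le> \<epsilon>"
    and "\<forall>(q, a)\<in>set h. \<not> bad q a"
  shows "measure_pmf.prob (stateless_play L A j h) {h. \<exists>(q, a)\<in>set h. bad q a} \<le> real j * \<epsilon>"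
  using assms(3)
proof (induction j arbitrary: h)
  case 0
  then have "h \<notin> {h. \<exists>(q, a)\<in>set h. bad q a}"
    by auto
  then show ?case
    by (simp add: measure_return_pmf indicator_def)
next
  case (Suc j)
  have "measure_pmf.prob (stateless_play L A (Suc j) h) {h. \<exists>(q, a)\<in>set h. bad q a} \<le> 0 + (\<epsilon> + real j * \<epsilon>)"
    unfolding stateless_play.simps
  proof (rule prob_bind_pmf_le[where B = "{}"])
    fix q assume q: "q \<in> set_pmf (A h)"
    show "measure_pmf.prob (bind_pmf (L q) (\<lambda>a. stateless_play L A j (h @ [(q, a)])))
        {h. \<exists>(q, a)\<in>set h. bad q a} \<le> \<epsilon> + real j * \<epsilon>"
    proof (rule prob_bind_pmf_le[OF L[OF q]])
      fix a assume "a \<notin> {a. bad q a}"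
      then show "measure_pmf.prob (stateless_play L A j (h @ [(q, a)]))
          {h. \<exists>(q, a)\<in>set h. bad q a} \<le> real j * \<epsilon>"
        using Suc.prems by (intro Suc.IH) auto
    qed (use \<open>0 \<le> \<epsilon>\<close> in simp)
  qed (use \<open>0 \<le> \<epsilon>\<close> in simp_all)
  then show ?case
    by (simp add: algebra_simps)
qed

text \<open>Hoeffding's inequality. Undoing the bias map doubles deviations, so with
  \<open>N\<close> coins an answer off by \<open>\<alpha> / 2\<close> means a head count off by
  \<open>N * \<alpha> / 4\<close>.\<close>

lemma coin_law_accurate:
  assumes v: "0 \<le> v \<and> v \<le> 1" and "0 < \<alpha>" and N: "0 < coin_count n k"
  shows "measure_pmf.prob (coin_law n k v) {a. \<alpha> / 2 < \<bar>a - v\<bar>} \<le> 2 * exp (- (real (coin_count n k) * \<alpha>\<^sup>2 / 8))"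
proof -
  let ?N = "real (coin_count n k)" and ?p = "1/4 + v / 2"
  interpret binomial_distribution "coin_count n k" ?p
    by unfold_locales (use v in auto)
  have "measure_pmf.prob (coin_law n k v) {a. \<alpha> / 2 < \<bar>a - v\<bar>} =
      measure_pmf.prob (binomial_pmf (coin_count n k) ?p) {c. \<alpha> / 2 < \<bar>coin_answer n k c - v\<bar>}"
    by (simp add: coin_law_def vimage_def)
  also have "\<dots> \<le> measure_pmf.prob (binomial_pmf (coin_count n k) ?p) {c. ?N * \<alpha> / 4 \<le> \<bar>real c - ?N * ?p\<bar>}"
  proof (rule measure_pmf.finite_measure_mono, rule Collect_mono, rule impI)
    fix c assume "\<alpha> / 2 < \<bar>coin_answer n k c - v\<bar>"
    moreover have eq: "real c - ?N * ?p = ?N / 2 * (coin_answer n k c - v)"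
      using N by (simp add: coin_answer_def field_simps)
    have "\<bar>real c - ?N * ?p\<bar> = ?N / 2 * \<bar>coin_answer n k c - v\<bar>"
      unfolding eq abs_mult by simp
    moreover have "?N / 2 * (\<alpha> / 2) \<le> ?N / 2 * \<bar>coin_answer n k c - v\<bar>"
      using calculation(1) by (intro mult_left_mono) auto
    ultimately show "?N * \<alpha> / 4 \<le> \<bar>real c - ?N * ?p\<bar>"
      by linarith
  qed simp
  also have "\<dots> \<le> 2 * exp (- 2 * (?N * \<alpha> / 4)\<^sup>2 / ?N)"
    using N \<open>0 < \<alpha>\<close> by (intro prob_abs_ge) auto
  also have "- 2 * (?N * \<alpha> / 4)\<^sup>2 / ?N = - (?N * \<alpha>\<^sup>2 / 8)"
    using N by (simp add: field_simps power2_eq_square)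
  finally show ?thesis .
qed

text \<open>The biases differ by half the difference of the query values, at most
  \<open>\<eta> / 4\<close> for \<open>\<eta> = 2 / n\<close>; the condition
  \<open>2 * b \<le> n\<close> says \<open>b * \<eta> \<le> 1\<close>.\<close>

lemma coin_law_holder_close:
  assumes v: "0 \<le> v \<and> v \<le> 1" "0 \<le> v' \<and> v' \<le> 1" "\<bar>v - v'\<bar> \<le> 1 / real n"
    and b: "2 \<le> b" "2 * b \<le> real n"
  shows "holder_close (b / (b - 1)) ((exp (b * (2 / real n)\<^sup>2) powr (b / (b - 1))) ^ coin_count n k)
    (coin_law n k v) (coin_law n k v')"
  unfolding coin_law_def
proof (intro holder_close_map holder_close_binomial holder_close_bernoulli)
  have "(1 / 4 + v / 2) - (1 / 4 + v' / 2) = (v - v') / 2"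
    by (simp add: field_simps)
  then show "\<bar>1 / 4 + v / 2 - (1 / 4 + v' / 2)\<bar> \<le> 2 / real n / 4"
    using v(3) by simp
  show "b * (2 / real n) \<le> 1"
    using b by (simp add: field_simps)
  show "1 < b / (b - 1)"
    using b by simp
qed (use v b in auto)

section \<open>From stability to statistical accuracy\<close>

context
  fixes \<Omega> :: "'a set" and n :: nat and g :: "nat \<Rightarrow> 'a \<Rightarrow> 'a \<Rightarrow> real" and \<mu> :: "'a list pmf"
  assumes chain: "undirected_markov_chain \<Omega> n g \<mu>"
begin

lemmas chain_facts = chain_simps[OF chain]

text \<open>Restricting the decoupling inequality to the event that some answer is wrong bounds the
  probability of this event directly: there, the chosen query is large on the sample.\<close>

lemma stable_accurate_imp_statistically_accurate:
  fixes G :: "'a list \<Rightarrow> 'a transcript pmf"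
  assumes stable: "\<And>S i y \<phi>. S \<in> tuples \<Omega> n \<Longrightarrow> i < n \<Longrightarrow> y \<in> \<Omega> \<Longrightarrow> (\<And>h. 0 \<le> \<phi> h \<and> \<phi> h \<le> 1) \<Longrightarrow>
      measure_pmf.expectation (G (S[i := y])) \<phi> \<le>
      (1 + \<alpha> / 8) * measure_pmf.expectation (G S) \<phi> + \<alpha> * \<beta> / 8"
    and accurate: "\<And>S. S \<in> tuples \<Omega> n \<Longrightarrow>
      measure_pmf.prob (G S) {h. \<exists>(q, a)\<in>set h. \<alpha> / 2 < \<bar>a - query_on q S\<bar>} \<le> \<alpha> * \<beta> / 32"
    and valid: "\<And>S h. S \<in> tuples \<Omega> n \<Longrightarrow> h \<in> set_pmf (G S) \<Longrightarrow>
      h \<noteq> [] \<and> (\<forall>(q, a)\<in>set h. \<forall>x\<in>\<Omega>. 0 \<le> q x \<and> q x \<le> 1)"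
    and \<alpha>: "0 < \<alpha>" "\<alpha> < 2"
  shows "measure_pmf.prob (bind_pmf \<mu> G)
    {h. Max ((\<lambda>(q, a). \<bar>query_mean q \<mu> - a\<bar>) ` set h) > \<alpha> + 2 * R_bar \<Omega> n g} \<le> \<beta>"
proof -
  let ?R = "R_bar \<Omega> n g"
  let ?wrong = "\<lambda>(q, a). \<alpha> + 2 * ?R < \<bar>query_mean q \<mu> - a\<bar>"
  define B where "B = {h. \<exists>p\<in>set h. ?wrong p}"
  \<comment> \<open>A wrongly answered query, chosen as a function of the transcript alone as
    \<open>decoupling\<close> requires; if there is none, \<open>indicator B\<close> masks the
    arbitrary value.\<close>
  define pick where "pick h = (SOME p. p \<in> set h \<and> ?wrong p)" for h
  \<comment> \<open>Complementing the query when the answer is too small makes the error point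
    upwards in both cases. The clamp gives the range [0, 1] for all histories and points, and
    changes nothing on \<Omega> for queries that occur.\<close>
  define f where "f h x = max 0 (min 1 (if query_mean (fst (pick h)) \<mu> < snd (pick h)
    then fst (pick h) x else 1 - fst (pick h) x))" for h x
  define E where "E S = {h. \<exists>(q, a)\<in>set h. \<alpha> / 2 < \<bar>a - query_on q S\<bar>}" for S :: "'a list"
  define J where "J = bind_pmf \<mu> (\<lambda>S. map_pmf (Pair S) (G S))"
  have J: "measure_pmf.expectation J (\<lambda>(S, h). F S h) =
      measure_pmf.expectation \<mu> (\<lambda>S. measure_pmf.expectation (G S) (F S))"
    if "\<And>S h. 0 \<le> F S h \<and> F S h \<le> C" for F :: "'a list \<Rightarrow> 'a transcript \<Rightarrow> real" and C
    unfolding J_def by (subst expectation_bind_pmf[where B = C]) (use that in auto)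
  have R: "0 \<le> ?R" "?R \<le> 1"
    by (rule R_bar_bounds[OF chain])+
  have f: "0 \<le> f h x \<and> f h x \<le> 1" for h x
    by (simp add: f_def)
  have on: "0 \<le> query_on (f h) S \<and> query_on (f h) S \<le> 1" for h S
    by (intro query_on_bounds f)
  have mean: "0 \<le> query_mean (f h) \<mu> \<and> query_mean (f h) \<mu> \<le> 1" for h
    unfolding query_mean_def by (intro conjI; rule expectation_pmf_bounds[where B = 1]; rule on)
  have cong: "query_mean q \<mu> = query_mean q' \<mu>" "S \<in> tuples \<Omega> n \<Longrightarrow> query_on q S = query_on q' S"
    if "\<And>x. x \<in> \<Omega> \<Longrightarrow> q x = q' x" for q q' S
  proof -
    show *: "query_on q S = query_on q' S" if "S \<in> tuples \<Omega> n" for S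
    proof -
      have "map q S = map q' S"
        using that \<open>\<And>x. x \<in> \<Omega> \<Longrightarrow> q x = q' x\<close> by (auto simp: tuples_def)
      then show ?thesis
        by (simp only: query_on_def)
    qed
    show "query_mean q \<mu> = query_mean q' \<mu>"
      unfolding query_mean_def expectation_tuples[OF chain_facts(1,4)]
      by (intro sum.cong refl) (simp add: *)
  qed
  have nonempty: "S \<noteq> []" if "S \<in> tuples \<Omega> n" for S
    using that chain_facts(3) by (auto simp: tuples_def)
  have complement: "query_mean (\<lambda>x. 1 - q x) \<mu> = 1 - query_mean q \<mu>" for q
  proof -
    have "(\<Sum>S\<in>tuples \<Omega> n. pmf \<mu> S) = 1"
      using expectation_tuples[OF chain_facts(1,4), of "\<lambda>_. 1"] by simp
    then show ?thesis
      unfolding query_mean_def expectation_tuples[OF chain_facts(1,4)]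
      by (simp add: query_on_complement nonempty right_diff_distrib sum_subtractf)
  qed
  \<comment> \<open>Off \<open>E S\<close> the answer is within \<open>\<alpha> / 2\<close> of the
    sample value, so a gap of \<open>\<alpha> / 2 + 2 * R_bar\<close> survives. On
    \<open>E S\<close> the left side is at most 1 + 1 + 2, whence the factor 4.\<close>
  have pointwise: "indicator B h * (query_mean (f h) \<mu> + (\<alpha> / 2 + 2 * ?R)) \<le>
      indicator B h * query_on (f h) S + 4 * indicator (E S) h"
    if S: "S \<in> tuples \<Omega> n" and h: "h \<in> set_pmf (G S)" for S h
  proof (cases "h \<in> B \<and> h \<notin> E S")
    case True
    obtain q a where qa: "pick h = (q, a)"
      by (cases "pick h")
    have "\<exists>p. p \<in> set h \<and> ?wrong p"
      using True by (auto simp: B_def)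
    then have "pick h \<in> set h \<and> ?wrong (pick h)"
      unfolding pick_def by (rule someI_ex)
    then have p: "(q, a) \<in> set h" "\<alpha> + 2 * ?R < \<bar>query_mean q \<mu> - a\<bar>"
      by (simp_all add: qa)
    have q: "0 \<le> q x \<and> q x \<le> 1" if "x \<in> \<Omega>" for x
      using valid[OF S h] p(1) that by blast
    have sample: "\<bar>a - query_on q S\<bar> \<le> \<alpha> / 2"
      using True p(1) by (force simp: E_def)
    have "query_mean (f h) \<mu> + (\<alpha> / 2 + 2 * ?R) \<le> query_on (f h) S"
    proof (cases "query_mean q \<mu> < a")
      case True
      have "f h x = q x" if "x \<in> \<Omega>" for x
        using q[OF that] True by (simp add: f_def qa)
      then have "query_mean (f h) \<mu> = query_mean q \<mu>" "query_on (f h) S = query_on q S"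
        using cong[of "f h" q] S by auto
      then show ?thesis
        using True p(2) sample by linarith
    next
      case False
      have "f h x = 1 - q x" if "x \<in> \<Omega>" for x
        using q[OF that] False by (simp add: f_def qa)
      then have "query_mean (f h) \<mu> = 1 - query_mean q \<mu>" "query_on (f h) S = 1 - query_on q S"
        using cong[of "f h" "\<lambda>x. 1 - q x"] S complement[of q] query_on_complement[OF nonempty[OF S], of q]
        by auto
      then show ?thesis
        using False p(2) sample by linarith
    qed
    then show ?thesis
      using True by simp
  next
    case False
    then show ?thesis
      using on[of h S] mean[of h] R \<alpha> by (auto simp: indicator_def)
  qed
  define P M Q W where "P = measure_pmf.expectation J (\<lambda>(S, h). indicator B h :: real)"
    and "M = measure_pmf.expectation J (\<lambda>(S, h). indicator B h * query_mean (f h) \<mu>)"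
    and "Q = measure_pmf.expectation J (\<lambda>(S, h). indicator B h * query_on (f h) S)"
    and "W = measure_pmf.expectation J (\<lambda>(S, h). indicator (E S) h :: real)"
  have int: "integrable (measure_pmf J) (\<lambda>(S, h). F S h)"
    if "\<And>S h. 0 \<le> F S h \<and> F S h \<le> 1" for F :: "'a list \<Rightarrow> 'a transcript \<Rightarrow> real"
    by (rule integrable_pmf_bounded[where B = 1]) (use that in auto)
  have intP: "integrable (measure_pmf J) (\<lambda>(S, h). indicator B h :: real)"
    and intM: "integrable (measure_pmf J) (\<lambda>(S, h). indicator B h * query_mean (f h) \<mu>)"
    and intQ: "integrable (measure_pmf J) (\<lambda>(S, h). indicator B h * query_on (f h) S)"
    and intW: "integrable (measure_pmf J) (\<lambda>(S, h). indicator (E S) h :: real)"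
    using mean on by (auto intro!: int simp: indicator_def)
  have shift: "measure_pmf.expectation J (\<lambda>(S, h). indicator B h * (query_mean (f h) \<mu> + r)) = M + r * P" for r
  proof -
    have eq: "(\<lambda>(S, h). indicator B h * (query_mean (f h) \<mu> + r)) =
        (\<lambda>x. (\<lambda>(S, h). indicator B h * query_mean (f h) \<mu>) x + r * (\<lambda>(S, h). indicator B h) x)"
      by (auto simp: fun_eq_iff distrib_left mult.commute)
    show ?thesis
      unfolding eq M_def P_def
      by (simp only: Bochner_Integration.integral_add[OF intM integrable_mult_right[OF intP]]
          integral_mult_right_zero)
  qed
  have "M + (\<alpha> / 2 + 2 * ?R) * P \<le> Q + 4 * W"
  proof -
    have "M + (\<alpha> / 2 + 2 * ?R) * P =
        measure_pmf.expectation J (\<lambda>(S, h). indicator B h * (query_mean (f h) \<mu> + (\<alpha> / 2 + 2 * ?R)))"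
      by (rule shift[symmetric])
    also have "\<dots> \<le> measure_pmf.expectation J (\<lambda>(S, h). indicator B h * query_on (f h) S + 4 * indicator (E S) h)"
    proof (rule expectation_pmf_le[where B = 4 and B' = 5])
      fix x :: "'a list \<times> 'a transcript"
      obtain S h where x: "x = (S, h)"
        by (cases x)
      show "0 \<le> (\<lambda>(S, h). indicator B h * (query_mean (f h) \<mu> + (\<alpha> / 2 + 2 * ?R))) x \<and>
          (\<lambda>(S, h). indicator B h * (query_mean (f h) \<mu> + (\<alpha> / 2 + 2 * ?R))) x \<le> 4"
        using mean[of h] R \<alpha> by (simp add: x indicator_def)
      show "0 \<le> (\<lambda>(S, h). indicator B h * query_on (f h) S + 4 * indicator (E S) h) x \<and>
          (\<lambda>(S, h). indicator B h * query_on (f h) S + 4 * indicator (E S) h) x \<le> (5 :: real)"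
        using on[of h S] by (simp add: x indicator_def)
      assume "x \<in> set_pmf J"
      then show "(\<lambda>(S, h). indicator B h * (query_mean (f h) \<mu> + (\<alpha> / 2 + 2 * ?R))) x \<le>
          (\<lambda>(S, h). indicator B h * query_on (f h) S + 4 * indicator (E S) h) x"
        using pointwise chain_facts(4) by (auto simp: J_def)
    qed
    also have "(\<lambda>(S, h). indicator B h * query_on (f h) S + 4 * indicator (E S) h) =
        (\<lambda>x. (\<lambda>(S, h). indicator B h * query_on (f h) S) x + 4 * (\<lambda>(S, h). indicator (E S) h) x)"
      by (auto simp: fun_eq_iff)
    finally show ?thesis
      unfolding Q_def W_def
      by (simp only: Bochner_Integration.integral_add[OF intQ integrable_mult_right[OF intW]]
          integral_mult_right_zero)
  qed
  moreover have "Q \<le> (1 + \<alpha> / 8) * (M + ?R * P) + \<alpha> * \<beta> / 8"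
  proof -
    have "Q = measure_pmf.expectation \<mu> (\<lambda>S. measure_pmf.expectation (G S) (\<lambda>h. indicator B h * query_on (f h) S))"
      unfolding Q_def by (rule J[where C = 1]) (use on in \<open>auto simp: indicator_def\<close>)
    also have "\<dots> \<le> (1 + \<alpha> / 8) * measure_pmf.expectation \<mu> (\<lambda>S. measure_pmf.expectation (G S)
        (\<lambda>h. indicator B h * (query_mean (f h) \<mu> + ?R))) + \<alpha> * \<beta> / 8"
      using \<alpha> by (intro decoupling[OF chain] stable f) auto
    also have "measure_pmf.expectation \<mu> (\<lambda>S. measure_pmf.expectation (G S)
        (\<lambda>h. indicator B h * (query_mean (f h) \<mu> + ?R))) = M + ?R * P"
      unfolding shift[symmetric]
    proof (rule J[where C = 2, symmetric])
      show "0 \<le> indicator B h * (query_mean (f h) \<mu> + ?R) \<and>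
          indicator B h * (query_mean (f h) \<mu> + ?R) \<le> 2" for h
        using mean[of h] R by (simp add: indicator_def)
    qed
    finally show ?thesis .
  qed
  moreover have "W \<le> \<alpha> * \<beta> / 32"
  proof -
    have "W = measure_pmf.expectation \<mu> (\<lambda>S. measure_pmf.prob (G S) (E S))"
      unfolding W_def by (subst J[where C = 1]) (auto simp: indicator_def)
    also have "\<dots> = (\<Sum>S\<in>tuples \<Omega> n. pmf \<mu> S * measure_pmf.prob (G S) (E S))"
      by (rule expectation_tuples[OF chain_facts(1,4)])
    also have "\<dots> \<le> (\<Sum>S\<in>tuples \<Omega> n. pmf \<mu> S * (\<alpha> * \<beta> / 32))"
      using accurate by (intro sum_mono mult_left_mono) (auto simp: E_def)
    also have "\<dots> = \<alpha> * \<beta> / 32"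
      using expectation_tuples[OF chain_facts(1,4), of "\<lambda>_. \<alpha> * \<beta> / 32", symmetric] by simp
    finally show ?thesis .
  qed
  moreover have "M \<le> P"
    unfolding M_def P_def
    by (rule expectation_pmf_le[where B = 1 and B' = 1]) (use mean in \<open>auto simp: indicator_def\<close>)
  moreover have "0 \<le> P"
    unfolding P_def by (rule expectation_pmf_bounds(1)[where B = 1]) (auto simp: indicator_def)
  ultimately have "\<alpha> / 4 * P \<le> \<alpha> / 4 * \<beta>"
  proof -
    assume le: "M + (\<alpha> / 2 + 2 * ?R) * P \<le> Q + 4 * W" "Q \<le> (1 + \<alpha> / 8) * (M + ?R * P) + \<alpha> * \<beta> / 8"
      "W \<le> \<alpha> * \<beta> / 32" "M \<le> P" "0 \<le> P"
    have RP: "?R * P \<le> P" "0 \<le> ?R * P"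
      using R le(5) by (auto simp: mult_left_le_one_le)
    \<comment> \<open>Of the gap \<open>\<alpha> / 2 * P\<close> the multiplicative error takes at
      most \<open>\<alpha> / 4 * P\<close>, because \<open>M\<close> and \<open>?R * P\<close> are
      at most \<open>P\<close>. The additive errors sum to \<open>\<alpha> * \<beta> / 8 + 4 *
      (\<alpha> * \<beta> / 32) = \<alpha> * \<beta> / 4\<close>.\<close>
    have "\<alpha> / 8 * (M + ?R * P) \<le> \<alpha> / 8 * (2 * P)"
      using \<alpha> le(4) RP by (intro mult_left_mono) auto
    then show ?thesis
      using le(1-3) RP(2) by (simp add: algebra_simps)
  qed
  then have "P \<le> \<beta>"
    using \<alpha> by simp
  moreover have "P = measure_pmf.prob (bind_pmf \<mu> G) B"
  proof -
    have "P = measure_pmf.expectation \<mu> (\<lambda>S. measure_pmf.expectation (G S) (indicator B))"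
      unfolding P_def by (rule J[where C = 1]) (auto simp: indicator_def)
    also have "\<dots> = measure_pmf.expectation (bind_pmf \<mu> G) (indicator B)"
      by (rule expectation_bind_pmf[where B = 1, symmetric]) (auto simp: indicator_def)
    finally show ?thesis by simp
  qed
  moreover have "measure_pmf.prob (bind_pmf \<mu> G)
    {h. Max ((\<lambda>(q, a). \<bar>query_mean q \<mu> - a\<bar>) ` set h) > \<alpha> + 2 * ?R} \<le> measure_pmf.prob (bind_pmf \<mu> G) B"
  proof (rule measure_pmf.finite_measure_mono_AE)
    show "AE h in bind_pmf \<mu> G. h \<in> {h. Max ((\<lambda>(q, a). \<bar>query_mean q \<mu> - a\<bar>) ` set h) > \<alpha> + 2 * ?R} \<longrightarrow> h \<in> B"
      unfolding AE_measure_pmf_iff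
    proof (intro ballI impI)
      fix h assume "h \<in> set_pmf (bind_pmf \<mu> G)"
        and h: "h \<in> {h. Max ((\<lambda>(q, a). \<bar>query_mean q \<mu> - a\<bar>) ` set h) > \<alpha> + 2 * ?R}"
      \<comment> \<open>\<open>Max\<close> of the empty set is unspecified; on a nonempty transcript
        it is attained.\<close>
      then have "h \<noteq> []"
        using valid chain_facts(4) by auto
      then have "Max ((\<lambda>(q, a). \<bar>query_mean q \<mu> - a\<bar>) ` set h) \<in> (\<lambda>(q, a). \<bar>query_mean q \<mu> - a\<bar>) ` set h"
        by (intro Max_in) auto
      then show "h \<in> B"
        using h unfolding B_def by fastforce
    qed
  qed simp
  ultimately show ?thesis
    by linarith
qed

lemma coin_program_statistically_accurate:
  assumes k: "1 \<le> k" and \<alpha>: "0 < \<alpha>" "\<alpha> < 2" and \<beta>: "0 < \<beta>" "\<beta> < 1"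
    and n: "10000 * sqrt (real k) / \<alpha>\<^sup>2 * ln (64 * real k / (\<alpha> * \<beta>)) \<le> real n"
  shows "statistically_accurate (program_mechanism coin_program k \<alpha> \<beta>) \<Omega> k (\<alpha> + 2 * R_bar \<Omega> n g) \<beta> \<mu>"
  unfolding statistically_accurate_def
proof (intro allI impI)
  fix A :: "'a adversary" assume A: "valid_adversary \<Omega> A"
  define G where "G S = stateless_play (\<lambda>q. coin_law n k (query_on q S)) A k []" for S
  define Q where "Q = {q :: 'a \<Rightarrow> real. \<forall>x\<in>\<Omega>. 0 \<le> q x \<and> q x \<le> 1}"
  have AQ: "set_pmf (A h) \<subseteq> Q" for h
    using A by (auto simp: valid_adversary_def Q_def)
  have on: "0 \<le> query_on q S \<and> query_on q S \<le> 1" if "q \<in> Q" "S \<in> tuples \<Omega> n" for q S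
    using that by (intro query_on_bounds) (auto simp: Q_def tuples_def)
  \<comment> \<open>\<open>w\<close> makes the union bound \<open>k * (2 * exp (- w))\<close> equal
    to \<open>\<alpha> * \<beta> / 32\<close>. With multiplicative error
    \<open>\<alpha> / 32\<close>, \<open>x\<close> and \<open>b\<close> make
    \<open>exp (- ((b - 1) * (\<alpha> / 32)))\<close> equal to
    \<open>\<alpha> * \<beta> / 16\<close>.\<close>
  define w x where "w = ln (64 * real k / (\<alpha> * \<beta>))" and "x = ln (16 / (\<alpha> * \<beta>))"
  define b where "b = 1 + 32 / \<alpha> * x"
  define s where "s = sqrt (real k)"
  define N where "N = real (coin_count n k)"
  have \<alpha>\<beta>: "0 < \<alpha> * \<beta>" "\<alpha> * \<beta> < 2"
    using \<alpha> \<beta> mult_strict_mono[of \<alpha> 2 \<beta> 1] by auto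
  have s: "1 \<le> s" "s * s = real k"
    using k by (auto simp: s_def)
  have x: "1 \<le> x"
  proof -
    have "exp 1 * (\<alpha> * \<beta>) \<le> 3 * 2"
      using exp_le \<alpha>\<beta> by (intro mult_mono) auto
    then have "exp 1 \<le> 16 / (\<alpha> * \<beta>)"
      using \<alpha>\<beta>(1) by (simp only: pos_le_divide_eq)
    then show ?thesis
      using \<alpha>\<beta> by (simp add: x_def ln_ge_iff)
  qed
  have "16 / (\<alpha> * \<beta>) \<le> 64 * real k / (\<alpha> * \<beta>)"
    using k \<alpha>\<beta> by (intro divide_right_mono) auto
  then have xw: "x \<le> w"
    unfolding x_def w_def using \<alpha>\<beta> k by (subst ln_le_cancel_iff) auto
  have n\<alpha>: "10000 * (s * w) \<le> real n * \<alpha>\<^sup>2"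
    using n \<alpha> by (simp add: s_def w_def field_simps)
  have sw: "s \<le> s * w"
    using s x xw by simp
  have b2: "2 \<le> b"
  proof -
    have "16 * 1 \<le> 32 / \<alpha> * x"
      using \<alpha> x by (intro mult_mono) (auto simp: le_divide_eq)
    then show ?thesis by (simp add: b_def)
  qed
  \<comment> \<open>This is what \<open>c \<le> \<alpha> / 32\<close> needs below; 128 * 34 = 4352
    is the largest demand made on the constant 10000.\<close>
  have bs: "128 * (b * s) \<le> real n * \<alpha>"
  proof -
    have "\<alpha> * b = \<alpha> + 32 * x"
      using \<alpha> by (simp add: b_def field_simps)
    then have "\<alpha> * b \<le> 34 * w"
      using \<alpha> x xw by linarith
    then have "128 * (\<alpha> * b) * s \<le> 128 * (34 * w) * s"
      using s by (intro mult_right_mono) auto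
    also have "\<dots> = 4352 * (s * w)"
      by simp
    also have "\<dots> \<le> real n * \<alpha>\<^sup>2"
      using n\<alpha> sw s by linarith
    finally have "(128 * (b * s)) * \<alpha> \<le> (real n * \<alpha>) * \<alpha>"
      by (simp add: power2_eq_square ac_simps)
    then show ?thesis
      using \<alpha> by simp
  qed
  have bn: "2 * b \<le> real n"
  proof -
    have "b \<le> b * s"
      using s b2 by simp
    moreover have "real n * \<alpha> \<le> real n * 2"
      using \<alpha> by (intro mult_left_mono) auto
    ultimately show ?thesis
      using bs b2 by linarith
  qed
  have n0: "0 < real n"
    using bn b2 by linarith
  have Ns: "N * s \<le> real n"
  proof (rule power2_le_imp_le)
    have "(N * s)\<^sup>2 = real ((coin_count n k)\<^sup>2 * k)"
      using s by (simp add: N_def power2_eq_square)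
    also have "\<dots> \<le> (real n)\<^sup>2"
      using coin_count_upper[of n k] by (simp only: of_nat_power[symmetric] of_nat_le_iff)
    finally show "(N * s)\<^sup>2 \<le> (real n)\<^sup>2" .
  qed simp
  have Ns': "real n < (N + 1) * s"
  proof (rule power_less_imp_less_base)
    have "(real n)\<^sup>2 < real ((coin_count n k + 1)\<^sup>2 * k)"
      using coin_count_lower[OF k, of n] by (simp only: of_nat_power[symmetric] of_nat_less_iff)
    also have "\<dots> = ((N + 1) * s)\<^sup>2"
      by (simp add: N_def s_def power_mult_distrib add.commute)
    finally show "(real n)\<^sup>2 < ((N + 1) * s)\<^sup>2" .
  qed (use s in \<open>simp add: N_def\<close>)
  have N\<alpha>: "8 * w \<le> N * \<alpha>\<^sup>2"
  proof -
    have "real n * \<alpha>\<^sup>2 \<le> real n * 4"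
      using \<alpha> power_mono[of \<alpha> 2 2] by (intro mult_left_mono) auto
    then have "2 * s \<le> real n"
      using n\<alpha> sw s by linarith
    then have "real n / 2 \<le> N * s"
      using Ns' by (simp add: distrib_right)
    then have "real n / 2 * \<alpha>\<^sup>2 \<le> N * s * \<alpha>\<^sup>2"
      by (intro mult_right_mono) auto
    also have "N * s * \<alpha>\<^sup>2 = s * (N * \<alpha>\<^sup>2)"
      by simp
    finally have "8 * (s * w) \<le> s * (N * \<alpha>\<^sup>2)"
      using n\<alpha> sw s by linarith
    then have "s * (8 * w) \<le> s * (N * \<alpha>\<^sup>2)"
      by (simp only: mult.left_commute)
    then show ?thesis
      using s by (simp only: mult_le_cancel_left_pos)
  qed
  have N0: "0 < coin_count n k"
  proof (rule ccontr)
    assume "\<not> 0 < coin_count n k"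
    then have "N = 0"
      by (simp add: N_def)
    then show False
      using N\<alpha> x xw by simp
  qed
  \<comment> \<open>The total exponent: \<open>N * k\<close> coins, each contributing
    \<open>b * \<eta>^2\<close> with \<open>\<eta> = 2 / n\<close>. As
    \<open>N * sqrt k \<le> n\<close>, it is at most \<open>4 * b * sqrt k / n\<close>.\<close>
  define c where "c = b * (2 / real n)\<^sup>2 * (N * real k)"
  have c: "0 \<le> c" "c \<le> \<alpha> / 32"
  proof -
    have bs0: "0 \<le> 4 * (b * s)"
      using b2 s(1) by (intro mult_nonneg_nonneg) auto
    show "0 \<le> c"
      unfolding c_def using b2 by (intro mult_nonneg_nonneg) (auto simp: N_def)
    have "c = 4 * (b * s) * (N * s) / (real n)\<^sup>2"
      unfolding c_def s(2)[symmetric] power_divide by simp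
    also have "\<dots> \<le> 4 * (b * s) * real n / (real n)\<^sup>2"
      by (intro divide_right_mono mult_left_mono Ns bs0) simp
    also have "\<dots> = 4 * (b * s) / real n"
      by (simp add: power2_eq_square)
    also have "\<dots> \<le> \<alpha> / 32"
    proof -
      have "4 * (b * s) \<le> \<alpha> / 32 * real n"
        using bs by (simp add: mult.commute)
      then show ?thesis
        using n0 by (simp only: pos_divide_le_eq)
    qed
    finally show "c \<le> \<alpha> / 32" .
  qed
  have "bind_pmf \<mu> (game (program_mechanism coin_program k \<alpha> \<beta>) A k) = bind_pmf \<mu> G"
    using chain_facts(4) A unfolding G_def
    by (intro bind_pmf_cong refl) (auto simp: tuples_def game_coin_program[where \<Omega> = \<Omega>])
  moreover have "measure_pmf.prob (bind_pmf \<mu> G)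
    {h. Max ((\<lambda>(q, a). \<bar>query_mean q \<mu> - a\<bar>) ` set h) > \<alpha> + 2 * R_bar \<Omega> n g} \<le> \<beta>"
  proof (rule stable_accurate_imp_statistically_accurate[OF _ _ _ \<alpha>])
    fix S i y and \<phi> :: "'a transcript \<Rightarrow> real"
    assume S: "S \<in> tuples \<Omega> n" and i: "i < n" and y: "y \<in> \<Omega>" and \<phi>: "\<And>h. 0 \<le> \<phi> h \<and> \<phi> h \<le> 1"
    let ?a = "b / (b - 1)"
    let ?D = "exp (b * (2 / real n)\<^sup>2) powr ?a"
    have "holder_close ?a ((?D ^ coin_count n k) ^ k) (G (S[i := y])) (G S)"
      unfolding G_def
    proof (rule holder_close_stateless_play[OF _ AQ])
      fix q assume q: "q \<in> Q"
      have "\<bar>query_on q (S[i := y]) - query_on q S\<bar> \<le> 1 / real n"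
        by (rule query_on_update_diff[OF S y i]) (use q in \<open>auto simp: Q_def\<close>)
      then show "holder_close ?a (?D ^ coin_count n k) (coin_law n k (query_on q (S[i := y])))
          (coin_law n k (query_on q S))"
        by (intro coin_law_holder_close on q S list_update_tuples y b2 bn)
    qed (use b2 in auto)
    moreover have "(?D ^ coin_count n k) ^ k = exp c powr ?a"
      by (simp add: powr_def exp_of_nat_mult[symmetric] c_def N_def ac_simps)
    ultimately have "measure_pmf.expectation (G (S[i := y])) \<phi> \<le>
        exp (c + \<alpha> / 32) * measure_pmf.expectation (G S) \<phi> + exp (c - (b - 1) * (\<alpha> / 32))"
      using b2 \<phi> by (intro holder_close_imp_approximately_private) auto
    also have "\<dots> \<le> (1 + \<alpha> / 8) * measure_pmf.expectation (G S) \<phi> + \<alpha> * \<beta> / 8"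
    proof (intro add_mono mult_right_mono)
      \<comment> \<open>Here \<open>c + \<alpha> / 32 \<le> \<alpha> / 16\<close>, and
        \<open>exp z \<le> 1 + 2 * z\<close> for \<open>z\<close> in [0, 1/2].\<close>
      show "exp (c + \<alpha> / 32) \<le> 1 + \<alpha> / 8"
        using real_exp_bound_lemma[of "c + \<alpha> / 32"] c \<alpha> by simp
      have "exp (c - (b - 1) * (\<alpha> / 32)) = exp c * (\<alpha> * \<beta> / 16)"
        using \<alpha> \<alpha>\<beta> by (simp add: b_def exp_diff x_def)
      also have "\<dots> \<le> 2 * (\<alpha> * \<beta> / 16)"
        using real_exp_bound_lemma[of c] c \<alpha> \<alpha>\<beta> by (intro mult_right_mono) auto
      finally show "exp (c - (b - 1) * (\<alpha> / 32)) \<le> \<alpha> * \<beta> / 8"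
        by simp
      show "0 \<le> measure_pmf.expectation (G S) \<phi>"
        by (rule expectation_pmf_bounds(1)[OF \<phi>])
    qed
    finally show "measure_pmf.expectation (G (S[i := y])) \<phi> \<le>
        (1 + \<alpha> / 8) * measure_pmf.expectation (G S) \<phi> + \<alpha> * \<beta> / 8" .
  next
    fix S assume S: "S \<in> tuples \<Omega> n"
    have "measure_pmf.prob (G S) {h. \<exists>(q, a)\<in>set h. \<alpha> / 2 < \<bar>a - query_on q S\<bar>} \<le>
        real k * (2 * exp (- (real (coin_count n k) * \<alpha>\<^sup>2 / 8)))"
      unfolding G_def
    proof (rule stateless_play_union_bound)
      fix h q assume "q \<in> set_pmf (A h)"
      then show "measure_pmf.prob (coin_law n k (query_on q S)) {a. \<alpha> / 2 < \<bar>a - query_on q S\<bar>} \<le>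
          2 * exp (- (real (coin_count n k) * \<alpha>\<^sup>2 / 8))"
        using AQ by (intro coin_law_accurate on S N0 \<alpha>) auto
    qed auto
    also have "\<dots> \<le> real k * (2 * exp (- w))"
      using N\<alpha> by (intro mult_left_mono) (auto simp: N_def)
    also have "\<dots> = \<alpha> * \<beta> / 32"
      using k \<alpha>\<beta> by (simp add: w_def exp_minus field_simps)
    finally show "measure_pmf.prob (G S) {h. \<exists>(q, a)\<in>set h. \<alpha> / 2 < \<bar>a - query_on q S\<bar>} \<le> \<alpha> * \<beta> / 32" .
  next
    fix S h assume "h \<in> set_pmf (G S)"
    then have "length h = k" "\<And>q a. (q, a) \<in> set h \<Longrightarrow> \<exists>h. q \<in> set_pmf (A h)"
      using stateless_play_support[of h _ A k "[]"] by (auto simp: G_def)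
    then show "h \<noteq> [] \<and> (\<forall>(q, a)\<in>set h. \<forall>x\<in>\<Omega>. 0 \<le> q x \<and> q x \<le> 1)"
      using k AQ by (fastforce simp: Q_def)
  qed
  ultimately show "measure_pmf.prob (bind_pmf \<mu> (game (program_mechanism coin_program k \<alpha> \<beta>) A k))
    {h. Max ((\<lambda>(q, a). \<bar>query_mean q \<mu> - a\<bar>) ` set h) > \<alpha> + 2 * R_bar \<Omega> n g} \<le> \<beta>"
    by simp
qed

text \<open>With any number of coins, even none, answers lie in [-1/2, 3/2] and means in [0, 1], so
  no error exceeds 3/2. The case arises because \<open>soft_O\<close> ranges over all \<alpha>: for
  fixed \<open>k\<close> and \<beta> its bound tends to 0 as \<alpha> grows, which forces sample
  size 0 for large \<alpha>.\<close>

lemma coin_program_trivially_accurate: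
  assumes k: "1 \<le> k" and \<alpha>: "2 \<le> \<alpha>" and \<beta>: "0 < \<beta>"
  shows "statistically_accurate (program_mechanism coin_program k \<alpha> \<beta>) \<Omega> k (\<alpha> + 2 * R_bar \<Omega> n g) \<beta> \<mu>"
  unfolding statistically_accurate_def
proof (intro allI impI)
  fix A :: "'a adversary" assume A: "valid_adversary \<Omega> A"
  let ?J = "bind_pmf \<mu> (game (program_mechanism coin_program k \<alpha> \<beta>) A k)"
  let ?bad = "{h. Max ((\<lambda>(q, a). \<bar>query_mean q \<mu> - a\<bar>) ` set h) > \<alpha> + 2 * R_bar \<Omega> n g}"
  have "h \<notin> ?bad" if h: "h \<in> set_pmf ?J" for h
  proof -
    obtain S where S: "S \<in> tuples \<Omega> n"
      and hS: "h \<in> set_pmf (stateless_play (\<lambda>q. coin_law n k (query_on q S)) A k [])"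
      using h chain_facts(4) A by (auto simp: tuples_def game_coin_program[where \<Omega> = \<Omega>])
    have "\<bar>query_mean q \<mu> - a\<bar> \<le> \<alpha>" if qa: "(q, a) \<in> set h" for q a
    proof -
      obtain h' where q: "q \<in> set_pmf (A h')" and a: "a \<in> set_pmf (coin_law n k (query_on q S))"
        using stateless_play_support(2)[OF hS qa] by auto
      have on: "0 \<le> query_on q T \<and> query_on q T \<le> 1" if "T \<in> tuples \<Omega> n" for T
        using that q A by (intro query_on_bounds) (auto simp: valid_adversary_def tuples_def)
      have "0 \<le> query_mean q \<mu>" "query_mean q \<mu> \<le> (\<Sum>S\<in>tuples \<Omega> n. pmf \<mu> S * 1)"
        unfolding query_mean_def expectation_tuples[OF chain_facts(1,4)]
        using on by (auto intro!: sum_nonneg sum_mono mult_left_mono simp del: mult_1_right)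
      then have mean: "0 \<le> query_mean q \<mu>" "query_mean q \<mu> \<le> 1"
        using expectation_tuples[OF chain_facts(1,4), of "\<lambda>_. 1"] by auto
      obtain c where c: "a = coin_answer n k c"
        "c \<in> set_pmf (binomial_pmf (coin_count n k) (1/4 + query_on q S / 2))"
        using a by (auto simp: coin_law_def)
      then have "c \<le> coin_count n k"
        using set_pmf_binomial_eq[of "1/4 + query_on q S / 2"] on[OF S] by (auto split: if_splits)
      then have "0 \<le> real c / real (coin_count n k)" "real c / real (coin_count n k) \<le> 1"
        by (auto simp: divide_le_eq_1)
      moreover have "a = 2 * (real c / real (coin_count n k)) - 1 / 2"
        by (simp add: c coin_answer_def)
      ultimately show ?thesis
        using mean \<alpha> by linarith
    qed
    moreover have "h \<noteq> []"
      using stateless_play_support(1)[OF hS] k by auto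
    ultimately have "Max ((\<lambda>(q, a). \<bar>query_mean q \<mu> - a\<bar>) ` set h) \<le> \<alpha>"
      by (subst Max_le_iff) auto
    then show ?thesis
      using R_bar_bounds(1)[OF chain] by simp
  qed
  then have "set_pmf ?J \<inter> ?bad = {}"
    by blast
  then have "measure_pmf.prob ?J ?bad = 0"
    by (simp add: measure_pmf_zero_iff)
  then show "measure_pmf.prob ?J ?bad \<le> \<beta>"
    using \<beta> by simp
qed

end

section \<open>The sample size\<close>

definition sample_size :: "nat \<Rightarrow> real \<Rightarrow> real \<Rightarrow> nat" where
  "sample_size k \<alpha> \<beta> = (if 2 \<le> \<alpha> then 0
     else nat \<lceil>10000 * sqrt (real k) / \<alpha>\<^sup>2 * ln (64 * real k / (\<alpha> * \<beta>))\<rceil>)"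

text \<open>For \<open>\<alpha> < 2\<close> the point is the factor \<open>k / \<alpha>\<close>
  inside the logarithm. With \<open>u = sqrt k / \<alpha>^2\<close> it equals
  \<open>u^2 * \<alpha>^3\<close>, at most \<open>8 * u^2\<close>, and \<open>u\<close> is at most
  the target function divided by \<open>l\<close>; so one logarithm of the target suffices.\<close>

lemma soft_O_sample_size: "soft_O sample_size (\<lambda>k \<alpha> \<beta>. sqrt (real k) / \<alpha>\<^sup>2 * ln (1 / \<beta>))"
  unfolding soft_O_def
proof (intro allI impI)
  fix \<beta>\<^sub>0 :: real assume \<beta>\<^sub>0: "0 < \<beta>\<^sub>0 \<and> \<beta>\<^sub>0 < 1"
  \<comment> \<open>A positive lower bound for \<open>ln (1 / \<beta>)\<close>, which lets constants
    be charged to that factor; the cap at 1 keeps \<open>ln (512 / l^2)\<close> nonnegative.\<close>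
  define l where "l = min 1 (ln (1 / \<beta>\<^sub>0))"
  have l: "0 < l" "l \<le> 1" "l \<le> ln (1 / \<beta>\<^sub>0)"
    using \<beta>\<^sub>0 by (auto simp: l_def)
  define K where "K = ln (512 / l\<^sup>2) + 2"
  have "l\<^sup>2 \<le> 1"
    using l by (simp add: power_le_one)
  then have ln0: "0 \<le> ln (512 / l\<^sup>2)"
    using l by (intro ln_ge_zero) (simp add: le_divide_eq)
  define C where "C = 20000 * (K / l + 1)"
  have C: "0 \<le> C"
    using ln0 l by (simp add: C_def K_def)
  have "real (sample_size k \<alpha> \<beta>) \<le> C * (sqrt (real k) / \<alpha>\<^sup>2 * ln (1 / \<beta>)) *
      ln (exp 1 + sqrt (real k) / \<alpha>\<^sup>2 * ln (1 / \<beta>)) ^ 1"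
    if k: "1 \<le> k" and \<alpha>: "0 < \<alpha>" and \<beta>: "0 < \<beta>" "\<beta> \<le> \<beta>\<^sub>0" for k \<alpha> \<beta>
  proof -
    define L u where "L = ln (1 / \<beta>)" and "u = sqrt (real k) / \<alpha>\<^sup>2"
    define M where "M = ln (exp 1 + u * L)"
    have "1 / \<beta>\<^sub>0 \<le> 1 / \<beta>"
      using \<beta> \<beta>\<^sub>0 by (simp add: frac_le)
    then have "ln (1 / \<beta>\<^sub>0) \<le> L"
      unfolding L_def using \<beta> \<beta>\<^sub>0 by (subst ln_le_cancel_iff) auto
    then have L: "l \<le> L" "0 < L"
      using l by auto
    have u: "0 < u"
      using k \<alpha> by (simp add: u_def)
    have uL: "0 < u * L"
      using u L by simp
    have pos: "0 < exp 1 + u * L"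
      by (rule add_pos_pos[OF exp_gt_zero uL])
    have "ln (exp 1) \<le> M"
      unfolding M_def using uL pos by (subst ln_le_cancel_iff) auto
    then have M: "1 \<le> M"
      by simp
    show ?thesis
    proof (cases "2 \<le> \<alpha>")
      case True
      have "0 \<le> C * (u * L) * M"
        using C uL M by simp
      then show ?thesis
        using True by (simp add: sample_size_def L_def u_def M_def)
    next
      case False
      define X where "X = 10000 * sqrt (real k) / \<alpha>\<^sup>2 * ln (64 * real k / (\<alpha> * \<beta>))"
      have "64 * real k / (\<alpha> * \<beta>) = (64 * real k / \<alpha>) * (1 / \<beta>)"
        by simp
      then have split: "ln (64 * real k / (\<alpha> * \<beta>)) = ln (64 * real k / \<alpha>) + L"
        unfolding L_def using k \<alpha> \<beta> by (subst ln_mult_pos[symmetric]) auto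
      have "64 * real k / \<alpha> \<le> 512 / l\<^sup>2 * (exp 1 + u * L)\<^sup>2"
      proof -
        have "\<alpha> ^ 3 \<le> 2 ^ 3"
          using \<alpha> False by (intro power_mono) auto
        then have "real k * \<alpha> ^ 3 / \<alpha> ^ 4 \<le> real k * 8 / \<alpha> ^ 4"
          using \<alpha> by (intro divide_right_mono mult_left_mono) auto
        moreover have "real k / \<alpha> = real k * \<alpha> ^ 3 / \<alpha> ^ 4"
          using \<alpha> by (simp add: field_simps power_numeral_reduce)
        moreover have "u\<^sup>2 = real k / \<alpha> ^ 4"
          by (simp add: u_def power_divide power_mult[symmetric])
        ultimately have "64 * real k / \<alpha> \<le> 512 * u\<^sup>2"
          by simp
        also have "u\<^sup>2 \<le> ((exp 1 + u * L) / l)\<^sup>2"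
        proof (rule power_mono)
          have "u * l \<le> u * L"
            using u L by (intro mult_left_mono) auto
          also have "\<dots> \<le> exp 1 + u * L"
            by simp
          finally show "u \<le> (exp 1 + u * L) / l"
            using l by (simp add: le_divide_eq)
        qed (use u in simp)
        finally show ?thesis
          by (simp add: power_divide)
      qed
      then have "ln (64 * real k / \<alpha>) \<le> ln (512 / l\<^sup>2 * (exp 1 + u * L)\<^sup>2)"
        using k \<alpha> l pos by (intro iffD2[OF ln_le_cancel_iff] mult_pos_pos) auto
      also have "\<dots> = ln (512 / l\<^sup>2) + 2 * M"
        using l pos by (subst ln_mult_pos) (auto simp: M_def ln_realpow)
      also have "\<dots> \<le> K * M"
        using ln0 M mult_left_mono[of 1 M "ln (512 / l\<^sup>2)"] by (simp add: K_def distrib_right)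
      also have "\<dots> \<le> K * M * (L / l)"
      proof -
        have "0 \<le> K * M"
          unfolding K_def using ln0 M by (intro mult_nonneg_nonneg) auto
        moreover have "1 \<le> L / l"
          using L l by simp
        ultimately show ?thesis
          using mult_left_mono[of 1 "L / l" "K * M"] by (simp only: mult_1_right)
      qed
      finally have "ln (64 * real k / \<alpha>) + L \<le> K * M * (L / l) + M * L"
        using mult_right_mono[of 1 M L] M L by linarith
      then have "10000 * u * (ln (64 * real k / \<alpha>) + L) \<le> 10000 * u * (K * M * (L / l) + M * L)"
        using u by (intro mult_left_mono) auto
      moreover have "X = 10000 * u * (ln (64 * real k / \<alpha>) + L)"
        by (simp add: X_def split u_def)
      ultimately have "X \<le> 10000 * u * (K * M * (L / l) + M * L)"
        by simp
      also have "\<dots> = C / 2 * (u * L) * M"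
        using l by (simp add: C_def field_simps)
      finally have X: "X \<le> C / 2 * (u * L) * M" .
      \<comment> \<open>Hence rounding up at most doubles \<open>X\<close>, which is why
        \<open>C\<close> contains 20000 = 2 * 10000.\<close>
      have "1 \<le> X"
      proof -
        have "\<alpha>\<^sup>2 \<le> 2\<^sup>2"
          using \<alpha> False by (intro power_mono) auto
        then have "\<alpha>\<^sup>2 \<le> 4"
          by simp
        moreover have "1 \<le> sqrt (real k)"
          using k by simp
        ultimately have "2500 * \<alpha>\<^sup>2 \<le> 10000 * sqrt (real k)"
          by linarith
        then have "2500 \<le> 10000 * sqrt (real k) / \<alpha>\<^sup>2"
          using \<alpha> by (simp only: pos_le_divide_eq zero_less_power)
        moreover have "1 \<le> ln (64 * real k / (\<alpha> * \<beta>))"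
        proof -
          have "\<alpha> * \<beta> \<le> 2 * 1"
            using \<alpha> \<beta> \<beta>\<^sub>0 False by (intro mult_mono) auto
          then have "exp 1 * (\<alpha> * \<beta>) \<le> 3 * 2"
            using exp_le \<alpha> \<beta> by (intro mult_mono) auto
          then have "exp 1 \<le> 64 * real k / (\<alpha> * \<beta>)"
            using k \<alpha> \<beta> by (simp add: le_divide_eq)
          then show ?thesis
            using k \<alpha> \<beta> by (simp add: ln_ge_iff)
        qed
        ultimately have "2500 * 1 \<le> X"
          unfolding X_def by (intro mult_mono) auto
        then show ?thesis by simp
      qed
      then have "real (nat \<lceil>X\<rceil>) \<le> 2 * X"
        by linarith
      moreover have "sample_size k \<alpha> \<beta> = nat \<lceil>X\<rceil>"
        using False by (simp only: sample_size_def X_def if_False)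
      ultimately have "real (sample_size k \<alpha> \<beta>) \<le> C * (u * L) * M"
        using X by simp
      then show ?thesis
        by (simp only: L_def u_def M_def power_one_right)
    qed
  qed
  then show "\<exists>C::real. \<exists>c::nat. \<forall>k \<alpha> \<beta>. 1 \<le> k \<and> 0 < \<alpha> \<and> 0 < \<beta> \<and> \<beta> \<le> \<beta>\<^sub>0 \<longrightarrow>
      real (sample_size k \<alpha> \<beta>) \<le> C * (sqrt (real k) / \<alpha>\<^sup>2 * ln (1 / \<beta>)) *
        ln (exp 1 + sqrt (real k) / \<alpha>\<^sup>2 * ln (1 / \<beta>)) ^ c"
    by blast
qed

theorem corollary3p9:
  shows "\<exists>(P :: cmd) (m :: nat \<Rightarrow> real \<Rightarrow> real \<Rightarrow> nat).
     polynomial_time P \<and>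
     soft_O m (\<lambda>k \<alpha> \<beta>. sqrt (real k) / \<alpha>\<^sup>2 * ln (1 / \<beta>)) \<and>
     (\<forall>(k :: nat) (\<alpha> :: real) (\<beta> :: real) (n :: nat) (\<Omega> :: 'a set)
        (g :: nat \<Rightarrow> 'a \<Rightarrow> 'a \<Rightarrow> real) (\<mu> :: 'a list pmf).
        1 \<le> k \<and> 0 < \<alpha> \<and> 0 < \<beta> \<and> \<beta> < 1 \<and> m k \<alpha> \<beta> \<le> n \<and> undirected_markov_chain \<Omega> n g \<mu> \<longrightarrow>
        statistically_accurate (program_mechanism P k \<alpha> \<beta>) \<Omega> k (\<alpha> + 2 * R_bar \<Omega> n g) \<beta> \<mu>)"
proof (intro exI[of _ coin_program] exI[of _ sample_size] conjI allI impI, goal_cases)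
  case 1
  show ?case
    by (rule coin_program_polynomial_time)
next
  case 2
  show ?case
    by (rule soft_O_sample_size)
next
  case (3 k \<alpha> \<beta> n \<Omega> g \<mu>)
  then show ?case
  proof (cases "2 \<le> \<alpha>")
    case True
    then show ?thesis
      using 3 by (intro coin_program_trivially_accurate) auto
  next
    case False
    then have "10000 * sqrt (real k) / \<alpha>\<^sup>2 * ln (64 * real k / (\<alpha> * \<beta>)) \<le> real n"
      using 3 by (simp add: sample_size_def)
    then show ?thesis
      using 3 False by (intro coin_program_statistically_accurate) auto
  qed
qed

end
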